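(* Let $0<M=M^*\in\mathbb C^{n\times n}$, $0\le D=D^*\in\mathbb C^{n\times n}$, and let $G\in\mathbb C^{n\times r}$ have rank $r$. Let $P(\lambda):=\lambda^2M+\lambda D+GG^*$ and $$S(\lambda):=\begin{bmatrix}\lambda M+D & G\\ G^* & -\lambda I_r\end{bmatrix}.$$ Suppose that $\operatorname{rank}\begin{bmatrix}D & G\end{bmatrix}=n-k$ with $k\ge 1$. (a) Then $S(\lambda)$ and $P(\lambda)$ have exactly $n+r-k$ nonzero eigenvalues, counting (algebraic) multiplicity. In particular, $0\in\Lambda(S)$ and the algebraic multiplicity of $0$ as an eigenvalue of $S$ is $k$. Also, $0\in\Lambda(P)$ and the algebraic multiplicity of $0$ as an eigenvalue of $P$ is $n+k-r$. (b) Let $$Q^*\begin{bmatrix}D & G\end{bmatrix}=\begin{bmatrix}\widehat D & \widehat G\\ 0_{k\times n} & 0_{k\times r}\end{bmatrix}$$ be a QR factorization, where $\begin{bmatrix}\widehat D&\widehat G\end{bmatrix}$ has full row rank $n-k$ (with $\widehat G\in\mathbb C^{(n-k)\times r}$) and $Q=\begin{bmatrix}Q_1&Q_2\end{bmatrix}\in\mathbb C^{n\times n}$ is unitary with $Q_2\in\mathbb C^{n\times k}$. Set $D_{11}:=Q_1^*DQ_1$ and partition $$Q^*MQ=\begin{bmatrix}M_{11}&M_{12}\\ M_{12}^*&M_{22}\end{bmatrix},\qquad M_{22}\in\mathbb C^{k\times k}.$$ Put $\widehat M:=M_{11}-M_{12}M_{22}^{-1}M_{12}^*$ and $$H(\lambda):=\lambda\begin{bmatrix}\widehat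 M&0\\0&-I_r\end{bmatrix}+\begin{bmatrix}D_{11}&\widehat G\\ \widehat G^*&0\end{bmatrix},\qquad \widehat P(\lambda):=\lambda^2\widehat M+\lambda D_{11}+\widehat G\widehat G^*.$$ Then $\widehat M>0$ and, for all $\lambda\in\mathbb C$, there exists a nonsingular matrix $X\in\mathbb C^{(n+r)\times(n+r)}$ such that $$X^*S(\lambda)X=\operatorname{diag}(H(\lambda),\ \lambda M_{22}),$$ and $$\Lambda(\widehat P)\setminus\{0\}=\Lambda(H)=\Lambda(S)\setminus\{0\}=\Lambda(P)\setminus\{0\}.$$ Additionally, if $n=k+r$, then $$\Lambda(\widehat P)=\Lambda(H)=\Lambda(S)\setminus\{0\}=\Lambda(P)\setminus\{0\}.$$
   Context: $A^*$ denotes the conjugate transpose. For Hermitian matrices, $X>Y$ (resp. $X\ge Y$) means that $X-Y$ is positive definite (resp. positive semidefinite). For a square matrix polynomial (or pencil) $R(\lambda)$ with $\det R\not\equiv0$, $\Lambda(R):=\{\lambda\in\mathbb C:\det R(\lambda)=0\}$; the algebraic multiplicity of $\mu\in\Lambda(R)$ is the multiplicity of $\mu$ as a root of $\det R(\lambda)$ (equivalently, the sum of its partial multiplicities in the Smith form). $\operatorname{diag}(\cdot,\cdot)$ denotes a block diagonal matrix. *)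

theory Defs
  imports
    "HOL-Computational_Algebra.Polynomial"
    "Jordan_Normal_Form.Matrix"
    "Jordan_Normal_Form.Determinant"
    "Jordan_Normal_Form.Gauss_Jordan_Elimination"
    "Jordan_Normal_Form.Schur_Decomposition"
    "Jordan_Normal_Form.DL_Rank"
begin

definition hermitian :: "complex mat \<Rightarrow> bool" where
  "hermitian A \<longleftrightarrow> square_mat A \<and> mat_adjoint A = A"

text \<open>For Hermitian \<open>A\<close> the number \<open>x\<^sup>* A x\<close> is real, so taking the real part loses nothing.\<close>

definition pos_def :: "complex mat \<Rightarrow> bool" where
  "pos_def A \<longleftrightarrow> hermitian A \<and>
     (\<forall>x \<in> carrier_vec (dim_row A). x \<noteq> 0\<^sub>v (dim_row A) \<longrightarrow> Re ((A *\<^sub>v x) \<bullet>c x) > 0)"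

definition pos_semidef :: "complex mat \<Rightarrow> bool" where
  "pos_semidef A \<longleftrightarrow> hermitian A \<and>
     (\<forall>x \<in> carrier_vec (dim_row A). Re ((A *\<^sub>v x) \<bullet>c x) \<ge> 0)"

definition unitary_mat :: "nat \<Rightarrow> complex mat \<Rightarrow> bool" where
  "unitary_mat n Q \<longleftrightarrow> Q \<in> carrier_mat n n \<and>
     mat_adjoint Q * Q = 1\<^sub>m n \<and> Q * mat_adjoint Q = 1\<^sub>m n"

text \<open>The block row \<open>[A B]\<close>, for \<open>A\<close> and \<open>B\<close> with equally many rows.\<close>

definition block_row :: "'a :: zero mat \<Rightarrow> 'a mat \<Rightarrow> 'a mat" where
  "block_row A B = four_block_mat A B (0\<^sub>m 0 (dim_col A)) (0\<^sub>m 0 (dim_col B))"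

text \<open>
  A matrix polynomial \<open>R(\<lambda>)\<close> is a matrix whose entries are polynomials, so that
  \<open>det R\<close> is itself a polynomial; the indeterminate \<open>\<lambda>\<close> is \<open>[:0, 1:]\<close>.
\<close>

type_synonym matpoly = "complex poly mat"

abbreviation const_mat :: "complex mat \<Rightarrow> matpoly" where
  "const_mat A \<equiv> map_mat (\<lambda>a. [:a:]) A"

definition eval_matpoly :: "matpoly \<Rightarrow> complex \<Rightarrow> complex mat" where
  "eval_matpoly R z = map_mat (\<lambda>p. poly p z) R"

definition regular_matpoly :: "matpoly \<Rightarrow> bool" where
  "regular_matpoly R \<longleftrightarrow> square_mat R \<and> det R \<noteq> 0"

definition eigvals :: "matpoly \<Rightarrow> complex set" where
  "eigvals R = {\<mu>. det (eval_matpoly R \<mu>) = 0}"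

text \<open>Meaningful for regular \<open>R\<close> only: \<open>Polynomial.order\<close> is unspecified at the zero polynomial.\<close>

definition alg_mult :: "matpoly \<Rightarrow> complex \<Rightarrow> nat" where
  "alg_mult R \<mu> = Polynomial.order \<mu> (det R)"

text \<open>\<open>\<lambda>\<^sup>2 M + \<lambda> D + G G\<^sup>*\<close>\<close>

definition P_poly :: "complex mat \<Rightarrow> complex mat \<Rightarrow> complex mat \<Rightarrow> matpoly" where
  "P_poly M D G =
     [:0, 1:]\<^sup>2 \<cdot>\<^sub>m const_mat M + [:0, 1:] \<cdot>\<^sub>m const_mat D + const_mat (G * mat_adjoint G)"

definition S_pencil :: "complex mat \<Rightarrow> complex mat \<Rightarrow> complex mat \<Rightarrow> matpoly" where
  "S_pencil M D G =
     four_block_mat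
       ([:0, 1:] \<cdot>\<^sub>m const_mat M + const_mat D)  (const_mat G)
       (const_mat (mat_adjoint G))              (- ([:0, 1:] \<cdot>\<^sub>m 1\<^sub>m (dim_col G)))"

definition H_pencil :: "complex mat \<Rightarrow> complex mat \<Rightarrow> complex mat \<Rightarrow> matpoly" where
  "H_pencil M D G =
     (let m = dim_row M; r = dim_col G in
       [:0, 1:] \<cdot>\<^sub>m const_mat (four_block_mat M (0\<^sub>m m r) (0\<^sub>m r m) (- 1\<^sub>m r))
       + const_mat (four_block_mat D G (mat_adjoint G) (0\<^sub>m r r)))"

text \<open>
  \<open>mat_inverse\<close> is option-valued; \<open>the\<close> yields the inverse of \<open>C\<close> if \<open>C\<close> is invertible,
  in particular if \<open>C\<close> is a diagonal block of a positive definite matrix.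
\<close>

definition schur_complement :: "complex mat \<Rightarrow> complex mat \<Rightarrow> complex mat \<Rightarrow> complex mat" where
  "schur_complement A B C = A - B * the (mat_inverse C) * mat_adjoint B"

end

theory Submission
  imports Defs
begin

text \<open>
  Let \<open>Q = [Q\<^sub>1 Q\<^sub>2]\<close> be invertible with \<open>Q\<^sub>2\<^sup>* [D G] = 0\<close>. Block elimination of
  \<open>M\<^sub>1\<^sub>2\<close> by \<open>W = Q\<^sub>1 - Q\<^sub>2 M\<^sub>2\<^sub>2\<^sup>-\<^sup>1 M\<^sub>1\<^sub>2\<^sup>*\<close> gives a matrix \<open>X\<close>, independent of
  \<open>\<lambda>\<close>, with \<open>X\<^sup>* S(\<lambda>) X = diag (H(\<lambda>), \<lambda> M\<^sub>2\<^sub>2)\<close>. Hence \<open>det S(\<lambda>)\<close> is a nonzero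
  multiple of \<open>\<lambda>\<^sup>k det H(\<lambda>)\<close>, where \<open>H(0)\<close> is nonsingular by semidefiniteness of \<open>D\<close> and the
  rank conditions; as \<open>det S\<close> has degree \<open>n + r\<close>, this determines all multiplicities of \<open>S\<close>. They
  carry over to \<open>P\<close> by \<open>\<lambda>\<^sup>n det S(\<lambda>) = (-\<lambda>)\<^sup>r det P(\<lambda>)\<close>, and likewise from \<open>H\<close> to
  the reduced quadratic polynomial.
\<close>

section \<open>Conjugate transposes\<close>

lemma dim_mat_adjoint [simp]:
  "dim_row (mat_adjoint A) = dim_col A" "dim_col (mat_adjoint A) = dim_row A"
  by (auto simp: mat_adjoint_def)

lemma mat_adjoint_carrier [simp]:
  "A \<in> carrier_mat n m \<Longrightarrow> mat_adjoint A \<in> carrier_mat m n"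
  by (intro carrier_matI) auto

lemma index_mat_adjoint [simp]:
  "i < dim_col A \<Longrightarrow> j < dim_row A \<Longrightarrow> mat_adjoint A $$ (i, j) = conjugate (A $$ (j, i))"
  by (simp add: mat_adjoint_def mat_of_rows_index)

lemma mat_adjoint_adjoint [simp]: "mat_adjoint (mat_adjoint A) = A"
  by (intro eq_matI) auto

lemma mat_adjoint_zero [simp]: "mat_adjoint (0\<^sub>m n m) = 0\<^sub>m m n"
  by (intro eq_matI) auto

lemma mat_adjoint_one [simp]: "mat_adjoint (1\<^sub>m n :: complex mat) = 1\<^sub>m n"
  by (intro eq_matI) auto

lemma mat_adjoint_mult:
  fixes A B :: "complex mat"
  assumes "A \<in> carrier_mat n m" "B \<in> carrier_mat m l"
  shows "mat_adjoint (A * B) = mat_adjoint B * mat_adjoint A"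
  using assms by (intro eq_matI) (auto simp: scalar_prod_def mult.commute)

lemma mat_adjoint_minus:
  fixes A B :: "complex mat"
  assumes "A \<in> carrier_mat n m" "B \<in> carrier_mat n m"
  shows "mat_adjoint (A - B) = mat_adjoint A - mat_adjoint B"
  using assms by (intro eq_matI) auto

lemma mat_adjoint_four_block:
  assumes "A \<in> carrier_mat n m" "B \<in> carrier_mat n l" "C \<in> carrier_mat p m" "D \<in> carrier_mat p l"
  shows "mat_adjoint (four_block_mat A B C D) =
    four_block_mat (mat_adjoint A) (mat_adjoint C) (mat_adjoint B) (mat_adjoint D)"
  using assms by (intro eq_matI) auto

lemma det_mat_adjoint:
  fixes A :: "complex mat"
  assumes "A \<in> carrier_mat n n"
  shows "det (mat_adjoint A) = cnj (det A)"
proof -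
  interpret comm_ring_hom cnj by unfold_locales auto
  have "mat_adjoint A = map_mat cnj (transpose_mat A)"
    using assms by (intro eq_matI) auto
  thus ?thesis using assms by (simp add: det_transpose)
qed

lemma mult_mat_vec_cscalar:
  fixes A :: "complex mat"
  assumes "A \<in> carrier_mat n m" "x \<in> carrier_vec m" "y \<in> carrier_vec n"
  shows "(A *\<^sub>v x) \<bullet>c y = x \<bullet>c (mat_adjoint A *\<^sub>v y)"
proof -
  have "conjugate (mat_adjoint A *\<^sub>v y) = transpose_mat A *\<^sub>v conjugate y"
    using assms by (intro eq_vecI) (auto simp: scalar_prod_def)
  moreover have "(A *\<^sub>v x) \<bullet> conjugate y = x \<bullet> (transpose_mat A *\<^sub>v conjugate y)"
    using assms transpose_vec_mult_scalar[of A n m x "conjugate y"]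
    by (metis carrier_vec_conjugate comm_scalar_prod mult_mat_vec_carrier transpose_carrier_mat)
  ultimately show ?thesis by simp
qed

section \<open>Block rows and uniqueness of block decompositions\<close>

lemma block_row_carrier [simp]:
  "A \<in> carrier_mat n a \<Longrightarrow> B \<in> carrier_mat n b \<Longrightarrow> block_row A B \<in> carrier_mat n (a + b)"
  unfolding block_row_def by (intro carrier_matI) auto

lemma block_row_mult_vec:
  fixes A B :: "'a :: comm_ring_1 mat"
  assumes "A \<in> carrier_mat n a" "B \<in> carrier_mat n b" "x \<in> carrier_vec a" "y \<in> carrier_vec b"
  shows "block_row A B *\<^sub>v (x @\<^sub>v y) = A *\<^sub>v x + B *\<^sub>v y"
proof -
  have "block_row A B *\<^sub>v (x @\<^sub>v y) =
    (A *\<^sub>v x + B *\<^sub>v y) @\<^sub>v (0\<^sub>m 0 a *\<^sub>v x + 0\<^sub>m 0 b *\<^sub>v y)"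
    using assms unfolding block_row_def by (subst four_block_mat_mult_vec) auto
  thus ?thesis using assms by (intro eq_vecI) auto
qed

text \<open>A block row is a four-block matrix with an empty lower half, so this is the general
  block product with inner dimension \<open>n + 0\<close>. It is how congruences by
  \<open>[Q1 Q2]\<close> and by \<open>X\<close> are computed blockwise.\<close>

lemma mat_adjoint_block_row_mult:
  fixes A B C D :: "complex mat"
  assumes "A \<in> carrier_mat n a" "B \<in> carrier_mat n b" "C \<in> carrier_mat n c" "D \<in> carrier_mat n d"
  shows "mat_adjoint (block_row A B) * block_row C D =
    four_block_mat (mat_adjoint A * C) (mat_adjoint A * D) (mat_adjoint B * C) (mat_adjoint B * D)"
proof -
  have 1: "mat_adjoint (block_row A B) =
    four_block_mat (mat_adjoint A) (0\<^sub>m a 0) (mat_adjoint B) (0\<^sub>m b 0)"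
    unfolding block_row_def using assms by (subst mat_adjoint_four_block) auto
  have 2: "0\<^sub>m 0 (dim_col C) = (0\<^sub>m 0 c :: complex mat)" "0\<^sub>m 0 (dim_col D) = (0\<^sub>m 0 d :: complex mat)"
    using assms by auto
  show ?thesis unfolding 1 unfolding block_row_def 2
    by (subst mult_four_block_mat[where ?nr1.0 = a and ?nr2.0 = b and ?n1.0 = n and ?n2.0 = 0
          and ?nc1.0 = c and ?nc2.0 = d]) (use assms in \<open>auto intro!: cong_four_block_mat eq_matI\<close>)
qed

lemma mult_block_row:
  fixes A B C :: "'a :: comm_ring_1 mat"
  assumes "A \<in> carrier_mat p n" "B \<in> carrier_mat n b" "C \<in> carrier_mat n c"
  shows "A * block_row B C = block_row (A * B) (A * C)"
  by (intro eq_matI) (use assms in \<open>auto simp: block_row_def scalar_prod_def\<close>)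

lemma mat_adjoint_block_row_mult_vec:
  fixes A B :: "complex mat"
  assumes "A \<in> carrier_mat n a" "B \<in> carrier_mat n b" "x \<in> carrier_vec n"
  shows "mat_adjoint (block_row A B) *\<^sub>v x = (mat_adjoint A *\<^sub>v x) @\<^sub>v (mat_adjoint B *\<^sub>v x)"
  by (intro eq_vecI) (use assms in \<open>auto simp: block_row_def scalar_prod_def\<close>)

text \<open>Once both sides share the block sizes, each block is recovered by offsetting indices by
  \<open>n\<close> and \<open>m\<close>. Equations such as the QR factorization are read off
  blockwise in this way.\<close>

lemma four_block_mat_inj:
  assumes "four_block_mat A1 B1 C1 D1 = four_block_mat A2 B2 C2 D2"
    "A1 \<in> carrier_mat n m" "A2 \<in> carrier_mat n m" "B1 \<in> carrier_mat n l" "B2 \<in> carrier_mat n l"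
    "C1 \<in> carrier_mat p m" "C2 \<in> carrier_mat p m" "D1 \<in> carrier_mat p l" "D2 \<in> carrier_mat p l"
  shows "A1 = A2" "B1 = B2" "C1 = C2" "D1 = D2"
proof -
  have *: "four_block_mat A1 B1 C1 D1 $$ (i, j) = four_block_mat A2 B2 C2 D2 $$ (i, j)" for i j
    using assms by simp
  show "A1 = A2"
  proof (intro eq_matI)
    fix i j assume "i < dim_row A2" "j < dim_col A2"
    thus "A1 $$ (i, j) = A2 $$ (i, j)" using *[of i j] assms(2-) by auto
  qed (use assms in auto)
  show "B1 = B2"
  proof (intro eq_matI)
    fix i j assume "i < dim_row B2" "j < dim_col B2"
    thus "B1 $$ (i, j) = B2 $$ (i, j)" using *[of i "m + j"] assms(2-) by auto
  qed (use assms in auto)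
  show "C1 = C2"
  proof (intro eq_matI)
    fix i j assume "i < dim_row C2" "j < dim_col C2"
    thus "C1 $$ (i, j) = C2 $$ (i, j)" using *[of "n + i" j] assms(2-) by auto
  qed (use assms in auto)
  show "D1 = D2"
  proof (intro eq_matI)
    fix i j assume "i < dim_row D2" "j < dim_col D2"
    thus "D1 $$ (i, j) = D2 $$ (i, j)" using *[of "n + i" "m + j"] assms(2-) by auto
  qed (use assms in auto)
qed

lemma block_row_inj:
  assumes "block_row A B = block_row C D" "A \<in> carrier_mat n a" "C \<in> carrier_mat n a"
    "B \<in> carrier_mat n b" "D \<in> carrier_mat n b"
  shows "A = C" "B = D"
  using assms four_block_mat_inj[of A B "0\<^sub>m 0 a" "0\<^sub>m 0 b" C D "0\<^sub>m 0 a" "0\<^sub>m 0 b" n a b 0]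
  unfolding block_row_def by auto

section \<open>Nonsingular matrices and their inverses\<close>

lemma det_nonzero_iff_inj:
  fixes A :: "'a :: field mat"
  assumes "A \<in> carrier_mat n n"
  shows "det A \<noteq> 0 \<longleftrightarrow> (\<forall>x \<in> carrier_vec n. A *\<^sub>v x = 0\<^sub>v n \<longrightarrow> x = 0\<^sub>v n)"
  using det_0_iff_vec_prod_zero_field[OF assms] by blast

lemma mat_inverse_the:
  fixes A :: "'a :: field mat"
  assumes "A \<in> carrier_mat n n" "det A \<noteq> 0"
  shows "the (mat_inverse A) \<in> carrier_mat n n"
    "A * the (mat_inverse A) = 1\<^sub>m n" "the (mat_inverse A) * A = 1\<^sub>m n"
proof -
  have "mat_inverse A \<noteq> None"
    using mat_inverse(1)[OF assms(1), of "()"] det_non_zero_imp_unit[OF assms, of "()"] by blast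
  then obtain B where "mat_inverse A = Some B" by blast
  with mat_inverse(2)[OF assms(1) this] show "the (mat_inverse A) \<in> carrier_mat n n"
    "A * the (mat_inverse A) = 1\<^sub>m n" "the (mat_inverse A) * A = 1\<^sub>m n" by auto
qed

lemma minus_zero_mat [simp]:
  fixes A :: "'a :: group_add mat"
  assumes "A \<in> carrier_mat n m"
  shows "A - 0\<^sub>m n m = A"
  using assms by (intro eq_matI) auto

lemma zero_mult_mat_vec [simp]:
  fixes x :: "'a :: comm_ring_1 vec"
  assumes "x \<in> carrier_vec m"
  shows "0\<^sub>m n m *\<^sub>v x = 0\<^sub>v n"
  using assms by (intro eq_vecI) auto

lemma mult_mat_vec_zero [simp]:
  fixes A :: "'a :: comm_ring_1 mat"
  assumes "A \<in> carrier_mat n m"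
  shows "A *\<^sub>v 0\<^sub>v m = 0\<^sub>v n"
  using assms by (intro eq_vecI) auto

section \<open>Rank factorization and rank normal form\<close>

text \<open>The coefficient vectors that express the columns of \<open>B\<close> through those of
  \<open>A\<close> are collected as the columns of \<open>Y\<close>.\<close>

lemma mult_eq_of_cols_in_col_space:
  fixes A B :: "'a :: field mat"
  assumes A: "A \<in> carrier_mat n a" and B: "B \<in> carrier_mat n b"
    and sub: "set (cols B) \<subseteq> LinearCombinations.module.span class_ring (module_vec TYPE('a) n) (set (cols A))"
  obtains Y where "Y \<in> carrier_mat a b" "B = A * Y"
proof -
  interpret vec_space "TYPE('a)" n .
  have "\<exists>y \<in> carrier_vec a. A *\<^sub>v y = col B j" if "j < b" for j
  proof -
    have "col B j \<in> set (cols B)" using that B by (metis carrier_matD(2) cols_length cols_nth nth_mem)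
    hence "col B j \<in> col_space A" using sub by (auto simp: col_space_def)
    thus ?thesis using A by (auto simp: col_space_eq[OF A])
  qed
  then obtain y where y: "\<And>j. j < b \<Longrightarrow> y j \<in> carrier_vec a" "\<And>j. j < b \<Longrightarrow> A *\<^sub>v y j = col B j"
    by metis
  define Y where "Y = mat_of_cols a (map y [0..<b])"
  have Y: "Y \<in> carrier_mat a b" unfolding Y_def by (intro carrier_matI) auto
  have "B = A * Y"
  proof (rule mat_col_eqI)
    fix j assume "j < dim_col (A * Y)"
    hence j: "j < b" using Y by simp
    hence "col Y j = y j" unfolding Y_def using y(1) by (subst col_mat_of_cols) auto
    thus "col B j = col (A * Y) j" using y(2)[OF j] j A Y by (subst col_mult2[OF A Y]) auto
  qed (use A B Y in auto)
  with Y show ?thesis using that by blast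
qed


text \<open>The columns of \<open>B\<close> form a maximal independent set of columns of
  \<open>A\<close>; there are \<open>s\<close> of them and they span the column space. The columns
  of \<open>C\<close> complete them to a basis, and \<open>Y\<close> and \<open>Z\<close> express
  \<open>A\<close> and \<open>B\<close> through each other.\<close>

lemma rank_factorization:
  fixes A :: "'a :: field mat"
  assumes A: "A \<in> carrier_mat n a" and rank: "vec_space.rank n A = s"
  obtains B C Y Z where "s \<le> n" "B \<in> carrier_mat n s" "C \<in> carrier_mat n (n - s)"
    "det (block_row B C) \<noteq> 0" "Y \<in> carrier_mat a s" "Z \<in> carrier_mat s a" "B = A * Y" "A = B * Z"
proof -
  interpret vec_space "TYPE('a)" n .
  have colsA: "set (cols A) \<subseteq> carrier_vec n" using A cols_dim by blast
  obtain S where S: "finite S" "maximal S (\<lambda>T. T \<subseteq> set (cols A) \<and> lin_indpt T)"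
    using maximal_exists_superset[of "set (cols A)" "\<lambda>T. T \<subseteq> set (cols A) \<and> lin_indpt T" "{}"]
      finite_lin_indpt2 by auto
  have S_sub: "S \<subseteq> set (cols A)" and S_li: "lin_indpt S" using S(2) by (auto simp: maximal_def)
  have card_S: "card S = s" using rank_card_indpt[OF A S(2)] rank by simp
  have S_carr: "S \<subseteq> carrier_vec n" using S_sub colsA by blast
  have span_S: "set (cols A) \<subseteq> span S"
  proof
    fix v assume v: "v \<in> set (cols A)"
    show "v \<in> span S"
    proof (rule ccontr)
      assume v': "v \<notin> span S"
      have "v \<notin> S" using v' S_carr span_mem by auto
      moreover have "lin_indpt (S \<union> {v})"
        using v v' colsA S_carr S_li lin_dep_iff_in_span[of S v] \<open>v \<notin> S\<close> by auto
      ultimately show False using S(2) v S_sub unfolding maximal_def by blast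
    qed
  qed
  \<comment> \<open>Maximality is first taken among independent sets containing \<open>S\<close>.
    Every superset of such a set contains \<open>S\<close> as well, so the result is maximal among
    all independent sets.\<close>
  obtain T where T: "S \<subseteq> T" "maximal T (\<lambda>T. T \<subseteq> carrier_vec n \<and> lin_indpt T)"
  proof -
    define P where "P = (\<lambda>T. S \<subseteq> T \<and> T \<subseteq> carrier_vec n \<and> lin_indpt T)"
    have "\<exists>T. finite T \<and> maximal T P"
      by (rule maximal_exists[where N = dim and B = S])
        (use S_carr S_li li_le_dim in \<open>auto simp: P_def\<close>)
    then obtain T where "maximal T P" by blast
    hence "S \<subseteq> T" "maximal T (\<lambda>T. T \<subseteq> carrier_vec n \<and> lin_indpt T)"
      unfolding maximal_def P_def by blast+
    thus ?thesis by (rule that)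
  qed
  have T_basis: "basis T" using max_li_is_basis T(2) by simp
  have T_carr: "T \<subseteq> carrier_vec n" and T_li: "lin_indpt T" using T(2) by (auto simp: maximal_def)
  have fin_T: "finite T" using li_le_dim(1)[of T] T_carr T_li by auto
  have card_T: "card T = n" using dim_basis[OF fin_T T_basis] dim_is_n by simp
  have sn: "s \<le> n" using card_mono[OF fin_T T(1)] card_S card_T by simp
  obtain bs where bs: "set bs = S" "distinct bs" using finite_distinct_list[OF S(1)] by blast
  obtain cs where cs: "set cs = T - S" "distinct cs" using finite_distinct_list[of "T - S"] fin_T by blast
  have len: "length bs = s" "length cs = n - s"
    using bs cs card_S card_T distinct_card[of bs] distinct_card[of cs] card_Diff_subset[OF S(1) T(1)] by auto
  define B where "B = mat_of_cols n bs"
  define C where "C = mat_of_cols n cs"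
  have B: "B \<in> carrier_mat n s" and C: "C \<in> carrier_mat n (n - s)"
    unfolding B_def C_def using len by auto
  have cols_B: "cols B = bs" unfolding B_def using bs S_carr by (intro cols_mat_of_cols) auto
  have BC: "block_row B C = mat_of_cols n (bs @ cs)"
    by (intro eq_matI) (auto simp: block_row_def B_def C_def mat_of_cols_index nth_append)
  have "cols (block_row B C) = bs @ cs"
    unfolding BC using bs cs T(1) T_carr S_carr by (intro cols_mat_of_cols) auto
  hence "rank (block_row B C) = n"
    using bs cs T(1) T_li block_row_carrier[OF B C] sn Un_absorb1[OF T(1)]
    by (intro lin_indpt_full_rank) auto
  hence det: "det (block_row B C) \<noteq> 0"
    using det_rank_iff[of "block_row B C"] block_row_carrier[OF B C] sn by simp
  have "set (cols B) \<subseteq> span (set (cols A))" unfolding cols_B bs(1)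
    using S_sub in_own_span[of "set (cols A)"] colsA by auto
  then obtain Y where Y: "Y \<in> carrier_mat a s" "B = A * Y"
    by (rule mult_eq_of_cols_in_col_space[OF A B])
  have "set (cols A) \<subseteq> span (set (cols B))" unfolding cols_B bs(1) by (rule span_S)
  then obtain Z where Z: "Z \<in> carrier_mat s a" "A = B * Z"
    by (rule mult_eq_of_cols_in_col_space[OF B A])
  show ?thesis using that[OF sn B C det Y(1) Z(1) Y(2) Z(2)] .
qed

lemma split_block_row:
  fixes A :: "'a :: zero mat"
  assumes "A \<in> carrier_mat n (a + b)"
  obtains B C where "B \<in> carrier_mat n a" "C \<in> carrier_mat n b" "A = block_row B C"
proof -
  let ?B = "mat n a (\<lambda>(i, j). A $$ (i, j))" and ?C = "mat n b (\<lambda>(i, j). A $$ (i, a + j))"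
  have "A = block_row ?B ?C" by (intro eq_matI) (use assms in \<open>auto simp: block_row_def\<close>)
  thus ?thesis by (intro that[of ?B ?C]) auto
qed

text \<open>\<open>[Q1 Q2]\<close> is the adjoint of the inverse of \<open>[B C]\<close> from
  \<open>rank_factorization\<close>, so the adjoint of \<open>Q2\<close> annihilates
  \<open>B\<close>, hence also \<open>A = B * Z\<close>. The matrix \<open>Y\<close> is a right
  inverse of \<open>mat_adjoint Q1 * A\<close> and thus certifies its full row rank.\<close>

lemma rank_normal_form:
  fixes A :: "complex mat"
  assumes A: "A \<in> carrier_mat n a" and rank: "vec_space.rank n A = s"
  obtains Q1 Q2 Y where "s \<le> n" "Q1 \<in> carrier_mat n s" "Q2 \<in> carrier_mat n (n - s)"
    "Y \<in> carrier_mat a s" "det (block_row Q1 Q2) \<noteq> 0"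
    "mat_adjoint Q1 * (A * Y) = 1\<^sub>m s" "mat_adjoint Q2 * A = 0\<^sub>m (n - s) a"
proof -
  obtain B C Y Z where s: "s \<le> n" and B: "B \<in> carrier_mat n s" and C: "C \<in> carrier_mat n (n - s)"
    and det: "det (block_row B C) \<noteq> 0" and Y: "Y \<in> carrier_mat a s" "B = A * Y"
    and Z: "Z \<in> carrier_mat s a" "A = B * Z"
    using rank_factorization[OF A rank] .
  have BC: "block_row B C \<in> carrier_mat n n" using block_row_carrier[OF B C] s by simp
  define P where "P = the (mat_inverse (block_row B C))"
  have P: "P \<in> carrier_mat n n" "P * block_row B C = 1\<^sub>m n"
    unfolding P_def using mat_inverse_the[OF BC det] by auto
  have "mat_adjoint P \<in> carrier_mat n (s + (n - s))" using P(1) s by simp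
  then obtain Q1 Q2 where Q: "Q1 \<in> carrier_mat n s" "Q2 \<in> carrier_mat n (n - s)"
    "mat_adjoint P = block_row Q1 Q2" by (rule split_block_row)
  have Padj: "P = mat_adjoint (block_row Q1 Q2)" using Q(3) mat_adjoint_adjoint[of P] by simp
  have "det P * det (block_row B C) = 1" using det_mult[OF P(1) BC] P(2) by simp
  hence "det P \<noteq> 0" by auto
  hence "det (block_row Q1 Q2) \<noteq> 0" using det_mat_adjoint[OF P(1)] Q(3) by simp
  moreover have "four_block_mat (mat_adjoint Q1 * B) (mat_adjoint Q1 * C) (mat_adjoint Q2 * B)
      (mat_adjoint Q2 * C) = four_block_mat (1\<^sub>m s) (0\<^sub>m s (n - s)) (0\<^sub>m (n - s) s) (1\<^sub>m (n - s))"
    using P(2) s unfolding Padj mat_adjoint_block_row_mult[OF Q(1,2) B C] by simp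
  from four_block_mat_inj[OF this, of s s "n - s" "n - s"]
  have "mat_adjoint Q1 * B = 1\<^sub>m s" "mat_adjoint Q2 * B = 0\<^sub>m (n - s) s"
    using Q(1,2) B C by (auto simp: mult_carrier_mat[of _ _ n])
  moreover from this(2) have "mat_adjoint Q2 * A = 0\<^sub>m (n - s) a"
    unfolding Z(2) using Q(2) B Z(1) by (subst assoc_mult_mat[symmetric, of _ "n - s" n _ s]) auto
  ultimately show ?thesis using that[OF s Q(1,2) Y(1)] Y(2) by simp
qed

text \<open>For \<open>s = r\<close> the matrix \<open>mat_adjoint Q1 * A\<close> of the normal form
  is square, so its right inverse \<open>Y\<close> is also a left inverse.\<close>

lemma full_col_rank_inj:
  fixes A :: "complex mat"
  assumes A: "A \<in> carrier_mat n r" and rank: "vec_space.rank n A = r"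
    and x: "x \<in> carrier_vec r" "A *\<^sub>v x = 0\<^sub>v n"
  shows "x = 0\<^sub>v r"
proof -
  obtain Q1 Q2 Y where Q: "Q1 \<in> carrier_mat n r" "Y \<in> carrier_mat r r"
    "mat_adjoint Q1 * (A * Y) = 1\<^sub>m r"
    using rank_normal_form[OF A rank] by metis
  have QA: "mat_adjoint Q1 * A \<in> carrier_mat r r" using Q(1) A by (auto simp: mult_carrier_mat[of _ _ n])
  have "(mat_adjoint Q1 * A) * Y = 1\<^sub>m r"
    using assoc_mult_mat[of "mat_adjoint Q1" r n A r Y r] Q A by simp
  hence "Y * (mat_adjoint Q1 * A) = 1\<^sub>m r" using mat_mult_left_right_inverse[OF QA Q(2)] by simp
  hence "x = Y *\<^sub>v ((mat_adjoint Q1 * A) *\<^sub>v x)"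
    using assoc_mult_mat_vec[OF Q(2) QA x(1)] x(1) by simp
  also have "(mat_adjoint Q1 * A) *\<^sub>v x = 0\<^sub>v r"
    using assoc_mult_mat_vec[of "mat_adjoint Q1" r n A r x] Q(1) A x
      mult_mat_vec_zero[of "mat_adjoint Q1" r n] by simp
  finally show ?thesis using Q(2) by simp
qed

text \<open>For \<open>s = n\<close> the square matrix \<open>A * Y\<close> has inverse
  \<open>mat_adjoint Q1\<close>; taking adjoints turns this into a left inverse of
  \<open>mat_adjoint A\<close>.\<close>

lemma full_row_rank_adjoint_inj:
  fixes A :: "complex mat"
  assumes A: "A \<in> carrier_mat n a" and rank: "vec_space.rank n A = n"
    and x: "x \<in> carrier_vec n" "mat_adjoint A *\<^sub>v x = 0\<^sub>v a"
  shows "x = 0\<^sub>v n"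
proof -
  obtain Q1 Q2 Y where Q: "Q1 \<in> carrier_mat n n" and Y: "Y \<in> carrier_mat a n"
    and QAY: "mat_adjoint Q1 * (A * Y) = 1\<^sub>m n"
    using rank_normal_form[OF A rank] by metis
  have AY: "A * Y \<in> carrier_mat n n" using A Y by simp
  have "(A * Y) * mat_adjoint Q1 = 1\<^sub>m n"
    using mat_mult_left_right_inverse[OF _ AY QAY] Q by simp
  hence "mat_adjoint ((A * Y) * mat_adjoint Q1) = 1\<^sub>m n" by simp
  hence 1: "Q1 * (mat_adjoint Y * mat_adjoint A) = 1\<^sub>m n"
    using mat_adjoint_mult[OF AY, of "mat_adjoint Q1" n] mat_adjoint_mult[OF A Y] Q by simp
  have "x = (Q1 * (mat_adjoint Y * mat_adjoint A)) *\<^sub>v x" unfolding 1 using x(1) by simp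
  also have "\<dots> = Q1 *\<^sub>v ((mat_adjoint Y * mat_adjoint A) *\<^sub>v x)"
    by (rule assoc_mult_mat_vec[OF Q _ x(1)]) (use A Y in \<open>auto simp: mult_carrier_mat[of _ _ a]\<close>)
  also have "(mat_adjoint Y * mat_adjoint A) *\<^sub>v x = mat_adjoint Y *\<^sub>v (mat_adjoint A *\<^sub>v x)"
    by (rule assoc_mult_mat_vec[of _ n a _ n]) (use A Y x in auto)
  finally show ?thesis
    using Q x mult_mat_vec_zero[of "mat_adjoint Y" n a] Y by simp
qed

section \<open>Positive definite and semidefinite matrices\<close>

lemma pos_defD:
  assumes "pos_def A" "A \<in> carrier_mat n n"
  shows "mat_adjoint A = A" "\<And>x. x \<in> carrier_vec n \<Longrightarrow> x \<noteq> 0\<^sub>v n \<Longrightarrow> Re ((A *\<^sub>v x) \<bullet>c x) > 0"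
  using assms by (auto simp: pos_def_def hermitian_def)

lemma pos_semidefD:
  assumes "pos_semidef A" "A \<in> carrier_mat n n"
  shows "mat_adjoint A = A" "\<And>x. x \<in> carrier_vec n \<Longrightarrow> Re ((A *\<^sub>v x) \<bullet>c x) \<ge> 0"
  using assms by (auto simp: pos_semidef_def hermitian_def)

lemma congruence_cscalar:
  fixes A W :: "complex mat"
  assumes "A \<in> carrier_mat n n" "W \<in> carrier_mat n m" "x \<in> carrier_vec m"
  shows "((mat_adjoint W * (A * W)) *\<^sub>v x) \<bullet>c x = (A *\<^sub>v (W *\<^sub>v x)) \<bullet>c (W *\<^sub>v x)"
proof -
  have "(mat_adjoint W * (A * W)) *\<^sub>v x = mat_adjoint W *\<^sub>v (A *\<^sub>v (W *\<^sub>v x))"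
    using assms assoc_mult_mat_vec[of "mat_adjoint W" m n "A * W" m x]
      assoc_mult_mat_vec[of A n n W m x] by simp
  thus ?thesis
    using assms mult_mat_vec_cscalar[of "mat_adjoint W" m n "A *\<^sub>v (W *\<^sub>v x)" x] by simp
qed

text \<open>The form of the congruent matrix at \<open>x\<close> is that of \<open>A\<close> at
  \<open>W x\<close>, which is nonzero for nonzero \<open>x\<close>. The uses below are
  \<open>W = Q2\<close>, for \<open>M22\<close>, and the elimination matrix, for the Schur
  complement.\<close>

lemma pos_def_congruence:
  assumes A: "A \<in> carrier_mat n n" "pos_def A" and W: "W \<in> carrier_mat n m"
    and inj: "\<And>x. x \<in> carrier_vec m \<Longrightarrow> W *\<^sub>v x = 0\<^sub>v n \<Longrightarrow> x = 0\<^sub>v m"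
  shows "pos_def (mat_adjoint W * (A * W))"
proof -
  have AW: "A * W \<in> carrier_mat n m" using A W by simp
  have B: "mat_adjoint W * (A * W) \<in> carrier_mat m m" using AW W by (auto simp: mult_carrier_mat[of _ _ n])
  have "mat_adjoint (mat_adjoint W * (A * W)) = mat_adjoint (A * W) * W"
    using mat_adjoint_mult[of "mat_adjoint W" m n "A * W" m] W AW by simp
  also have "\<dots> = mat_adjoint W * (A * W)"
    using mat_adjoint_mult[OF A(1) W] pos_defD(1)[OF A(2,1)] assoc_mult_mat[of "mat_adjoint W" m n A n W m] A W
    by simp
  finally have "hermitian (mat_adjoint W * (A * W))" using B by (auto simp: hermitian_def)
  moreover have "Re (((mat_adjoint W * (A * W)) *\<^sub>v x) \<bullet>c x) > 0"
    if x: "x \<in> carrier_vec m" "x \<noteq> 0\<^sub>v m" for x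
    unfolding congruence_cscalar[OF A(1) W x(1)]
    using x inj W by (intro pos_defD(2)[OF A(2,1)]) auto
  ultimately show ?thesis using B unfolding pos_def_def by auto
qed

lemma pos_def_det_nonzero:
  assumes "A \<in> carrier_mat n n" "pos_def A"
  shows "det A \<noteq> 0"
  unfolding det_nonzero_iff_inj[OF assms(1)]
  using pos_defD(2)[OF assms(2,1)] by force

text \<open>Since \<open>q(t) = (x + t A x)\<^sup>* A (x + t A x) = 2 t |A x|\<^sup>2 + t\<^sup>2 (A x)\<^sup>* A (A x)\<close> is nonnegative
  for all real \<open>t\<close>, its linear coefficient vanishes.\<close>

lemma pos_semidef_kernel:
  assumes A: "A \<in> carrier_mat n n" "pos_semidef A"
    and x: "x \<in> carrier_vec n" "(A *\<^sub>v x) \<bullet>c x = 0"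
  shows "A *\<^sub>v x = 0\<^sub>v n"
proof (rule ccontr)
  define v where "v = A *\<^sub>v x"
  have v: "v \<in> carrier_vec n" and Av: "A *\<^sub>v v \<in> carrier_vec n" using A x by (auto simp: v_def)
  assume "A *\<^sub>v x \<noteq> 0\<^sub>v n"
  hence "v \<bullet>c v > 0" using conjugate_square_greater_0_vec[OF v] v_def by simp
  hence pos: "Re (v \<bullet>c v) > 0" by (simp add: less_complex_def)
  define c where "c = Re ((A *\<^sub>v v) \<bullet>c v)"
  have c: "c \<ge> 0" unfolding c_def using pos_semidefD(2)[OF A(2,1) v] .
  \<comment> \<open>Since \<open>A\<close> is Hermitian, the cross term is again the squared norm of
    \<open>v\<close>, which accounts for the factor 2 in \<open>q\<close>.\<close>
  have Avx: "(A *\<^sub>v v) \<bullet>c x = v \<bullet>c v"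
    using mult_mat_vec_cscalar[OF A(1) v x(1)] pos_semidefD(1)[OF A(2,1)] v_def by simp
  have q: "0 \<le> 2 * t * Re (v \<bullet>c v) + t\<^sup>2 * c" for t :: real
  proof -
    let ?t = "complex_of_real t"
    let ?y = "x + ?t \<cdot>\<^sub>v v"
    have y: "?y \<in> carrier_vec n" using x v by simp
    have "A *\<^sub>v ?y = v + ?t \<cdot>\<^sub>v (A *\<^sub>v v)"
      using mult_add_distrib_mat_vec[OF A(1) x(1), of "?t \<cdot>\<^sub>v v"] mult_mat_vec[OF A(1) v] v
      by (simp add: v_def)
    moreover have "conjugate ?y = conjugate x + ?t \<cdot>\<^sub>v conjugate v"
      using conjugate_add_vec[OF x(1), of "?t \<cdot>\<^sub>v v"] v by (simp add: conjugate_smult_vec)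
    ultimately have "(A *\<^sub>v ?y) \<bullet>c ?y = (v + ?t \<cdot>\<^sub>v (A *\<^sub>v v)) \<bullet> (conjugate x + ?t \<cdot>\<^sub>v conjugate v)"
      by simp
    also have "\<dots> = v \<bullet>c x + ?t * ((A *\<^sub>v v) \<bullet>c x) + ?t * (v \<bullet>c v) + ?t * ?t * ((A *\<^sub>v v) \<bullet>c v)"
      using x(1) v Av
      by (simp add: scalar_prod_add_distrib[of _ n] add_scalar_prod_distrib[of _ n] algebra_simps)
    also have "\<dots> = 2 * ?t * (v \<bullet>c v) + ?t * ?t * ((A *\<^sub>v v) \<bullet>c v)"
      using x(2) Avx by (simp add: v_def)
    finally have "Re ((A *\<^sub>v ?y) \<bullet>c ?y) = 2 * t * Re (v \<bullet>c v) + t\<^sup>2 * c"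
      by (simp add: c_def power2_eq_square)
    thus ?thesis using pos_semidefD(2)[OF A(2,1) y] by simp
  qed
  \<comment> \<open>At \<open>t = - s\<close> the quadratic takes the value
    \<open>- s^2 (2 + c)\<close>, which is negative. The denominator \<open>1 + c\<close> rather
    than \<open>c\<close> also covers \<open>c = 0\<close>.\<close>
  define s where "s = Re (v \<bullet>c v) / (1 + c)"
  have s: "s > 0" "Re (v \<bullet>c v) = s * (1 + c)" using pos c by (auto simp: s_def)
  have "s\<^sup>2 * (2 + c) > 0" using s c by (intro mult_pos_pos) auto
  moreover have "2 * (- s) * (s * (1 + c)) + (- s)\<^sup>2 * c = - (s\<^sup>2 * (2 + c))"
    by (simp add: power2_eq_square algebra_simps)
  ultimately show False using q[of "- s"] unfolding s(2) by simp
qed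

section \<open>Evaluation, determinants and multiplicities of matrix polynomials\<close>

text \<open>Evaluation at \<open>z\<close> is a ring homomorphism. Through it, identities between
  determinants of matrix polynomials reduce to identities of complex matrices at every
  point.\<close>

lemma poly_det: "poly (det R) z = det (eval_matpoly R z)"
  unfolding eval_matpoly_def
  by (rule comm_ring_hom.hom_det[OF poly_hom.comm_ring_hom_axioms, symmetric])

lemma eigvals_eq_roots: "eigvals R = {\<mu>. poly (det R) \<mu> = 0}"
  by (simp add: eigvals_def poly_det)

lemma eval_S_pencil:
  assumes "M \<in> carrier_mat n n" "D \<in> carrier_mat n n" "G \<in> carrier_mat n r"
  shows "eval_matpoly (S_pencil M D G) z =
    four_block_mat (z \<cdot>\<^sub>m M + D) G (mat_adjoint G) (- (z \<cdot>\<^sub>m 1\<^sub>m r))"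
  unfolding eval_matpoly_def S_pencil_def using assms by (intro eq_matI) auto

lemma eval_H_pencil:
  assumes "M \<in> carrier_mat n n" "D \<in> carrier_mat n n" "G \<in> carrier_mat n r"
  shows "eval_matpoly (H_pencil M D G) z =
    four_block_mat (z \<cdot>\<^sub>m M + D) G (mat_adjoint G) (- (z \<cdot>\<^sub>m 1\<^sub>m r))"
  unfolding eval_matpoly_def H_pencil_def Let_def using assms by (intro eq_matI) auto

lemma eval_P_poly:
  assumes "M \<in> carrier_mat n n" "D \<in> carrier_mat n n" "G \<in> carrier_mat n r"
  shows "eval_matpoly (P_poly M D G) z = z\<^sup>2 \<cdot>\<^sub>m M + z \<cdot>\<^sub>m D + G * mat_adjoint G"
  unfolding eval_matpoly_def P_poly_def using assms by (intro eq_matI) auto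

text \<open>Multiplying \<open>S(\<lambda>)\<close> from the left by \<open>[\<lambda> I, G; 0, I]\<close> clears its upper right block.\<close>

lemma det_linearization:
  fixes M D G :: "complex mat"
  assumes M: "M \<in> carrier_mat n n" and D: "D \<in> carrier_mat n n" and G: "G \<in> carrier_mat n r"
  shows "z ^ n * det (four_block_mat (z \<cdot>\<^sub>m M + D) G (mat_adjoint G) (- (z \<cdot>\<^sub>m 1\<^sub>m r))) =
    (- z) ^ r * det (z\<^sup>2 \<cdot>\<^sub>m M + z \<cdot>\<^sub>m D + G * mat_adjoint G)"
proof -
  let ?S = "four_block_mat (z \<cdot>\<^sub>m M + D) G (mat_adjoint G) (- (z \<cdot>\<^sub>m 1\<^sub>m r))"
  let ?L = "four_block_mat (z \<cdot>\<^sub>m 1\<^sub>m n) G (0\<^sub>m r n) (1\<^sub>m r)"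
  let ?P = "z\<^sup>2 \<cdot>\<^sub>m M + z \<cdot>\<^sub>m D + G * mat_adjoint G"
  have L: "det ?L = z ^ n"
    using G by (subst det_four_block_mat_lower_left_zero[of _ n _ r]) auto
  have neg: "det (- (z \<cdot>\<^sub>m 1\<^sub>m r)) = (- z) ^ r"
  proof -
    have "- (z \<cdot>\<^sub>m 1\<^sub>m r) = (- z) \<cdot>\<^sub>m 1\<^sub>m r" by (intro eq_matI) auto
    thus ?thesis by simp
  qed
  have "?L * ?S = four_block_mat ?P (0\<^sub>m n r) (mat_adjoint G) (- (z \<cdot>\<^sub>m 1\<^sub>m r))"
  proof (subst mult_four_block_mat[of _ n n _ r _ r _ _ n _ r])
    have "z \<cdot>\<^sub>m 1\<^sub>m n * (z \<cdot>\<^sub>m M + D) = z\<^sup>2 \<cdot>\<^sub>m M + z \<cdot>\<^sub>m D"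
      using M D by (intro eq_matI) (auto simp: power2_eq_square algebra_simps)
    moreover have "z \<cdot>\<^sub>m 1\<^sub>m n * G + G * (- (z \<cdot>\<^sub>m 1\<^sub>m r)) = 0\<^sub>m n r"
    proof -
      have "G * (- (z \<cdot>\<^sub>m 1\<^sub>m r)) = - (z \<cdot>\<^sub>m G)"
        using mult_smult_distrib[OF G, of "1\<^sub>m r" r z] G by simp
      moreover have "z \<cdot>\<^sub>m 1\<^sub>m n * G = z \<cdot>\<^sub>m G" using mult_smult_assoc_mat[of "1\<^sub>m n" n n G r z] G by simp
      ultimately show ?thesis using G by (intro eq_matI) auto
    qed
    ultimately show "four_block_mat (z \<cdot>\<^sub>m 1\<^sub>m n * (z \<cdot>\<^sub>m M + D) + G * mat_adjoint G)
     (z \<cdot>\<^sub>m 1\<^sub>m n * G + G * - (z \<cdot>\<^sub>m 1\<^sub>m r)) (0\<^sub>m r n * (z \<cdot>\<^sub>m M + D) + 1\<^sub>m r * mat_adjoint G)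
     (0\<^sub>m r n * G + 1\<^sub>m r * - (z \<cdot>\<^sub>m 1\<^sub>m r)) = four_block_mat ?P (0\<^sub>m n r) (mat_adjoint G) (- (z \<cdot>\<^sub>m 1\<^sub>m r))"
      using M D G by (intro cong_four_block_mat) auto
  qed (use M D G in auto)
  hence "det ?L * det ?S = det ?P * det (- (z \<cdot>\<^sub>m 1\<^sub>m r))"
    using M D G by (subst det_mult[symmetric, of _ "n + r"])
      (auto simp: det_four_block_mat_upper_right_zero[of _ n _ r])
  thus ?thesis unfolding L neg by (simp add: mult.commute)
qed

text \<open>With \<open>C\<close> equal to minus the inverse of \<open>A\<close> times
  \<open>B\<close>, the pencil factors as \<open>A (z I - C)\<close>. Hence \<open>p\<close> is
  \<open>det A\<close> times the characteristic polynomial of \<open>C\<close>, which is monic of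
  degree \<open>n\<close>.\<close>

lemma det_pencil_degree:
  fixes A B :: "complex mat"
  assumes A: "A \<in> carrier_mat n n" "det A \<noteq> 0" and B: "B \<in> carrier_mat n n"
    and p: "\<And>z. poly p z = det (z \<cdot>\<^sub>m A + B)"
  shows "degree p = n"
proof -
  define C where "C = the (mat_inverse A) * (- B)"
  have C: "C \<in> carrier_mat n n" "A * C = - B"
  proof -
    note i = mat_inverse_the[OF A]
    show "C \<in> carrier_mat n n" using i(1) B by (simp add: C_def)
    show "A * C = - B" using assoc_mult_mat[OF A(1) i(1), of "- B" n] i(2) B by (simp add: C_def)
  qed
  have "poly p z = det A * poly (char_poly C) z" for z
  proof -
    have "eval_matpoly (char_poly_matrix C) z = z \<cdot>\<^sub>m 1\<^sub>m n - C"
      using C(1) by (intro eq_matI) (auto simp: eval_matpoly_def char_poly_matrix_def)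
    hence "poly (char_poly C) z = det (z \<cdot>\<^sub>m 1\<^sub>m n - C)" unfolding char_poly_def poly_det by simp
    moreover have "A * (z \<cdot>\<^sub>m 1\<^sub>m n - C) = z \<cdot>\<^sub>m A + B"
    proof -
      have "A * (z \<cdot>\<^sub>m 1\<^sub>m n - C) = A * (z \<cdot>\<^sub>m 1\<^sub>m n) - A * C"
        by (rule mult_minus_distrib_mat[OF A(1) _ C(1)]) simp
      also have "A * (z \<cdot>\<^sub>m 1\<^sub>m n) = z \<cdot>\<^sub>m A" using mult_smult_distrib[OF A(1), of "1\<^sub>m n" n z] A by simp
      finally show ?thesis unfolding C(2) using A B by (intro eq_matI) auto
    qed
    ultimately show ?thesis using det_mult[OF A(1), of "z \<cdot>\<^sub>m 1\<^sub>m n - C"] minus_carrier_mat[OF C(1)] p by simp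
  qed
  hence "p = smult (det A) (char_poly C)" by (intro poly_ext) simp
  thus ?thesis using A(2) degree_monic_char_poly[OF C(1)] by simp
qed

text \<open>Over the complex numbers the orders of all roots add up to the degree; the share of the
  point 0 is split off.\<close>

lemma sum_order_nonzero_roots:
  fixes p :: "complex poly"
  assumes "p \<noteq> 0"
  shows "(\<Sum>\<mu> \<in> {\<mu>. poly p \<mu> = 0} - {0}. Polynomial.order \<mu> p) = degree p - Polynomial.order 0 p"
proof -
  let ?R = "{\<mu>. poly p \<mu> = 0}"
  have fin: "finite ?R" using assms poly_roots_finite by blast
  have "degree p = (\<Sum>\<mu> \<in> ?R. Polynomial.order \<mu> p)"
    using assms size_proots_complex[of p] by (simp add: size_multiset_overloaded_eq)
  \<comment> \<open>Adding the point 0 changes nothing: if it is not a root, its order is 0.\<close>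
  also have "\<dots> = (\<Sum>\<mu> \<in> insert 0 (?R - {0}). Polynomial.order \<mu> p)"
    using fin by (intro sum.mono_neutral_left) (auto simp: order_root)
  also have "\<dots> = Polynomial.order 0 p + (\<Sum>\<mu> \<in> ?R - {0}. Polynomial.order \<mu> p)"
    using fin by (subst sum.insert) auto
  finally show ?thesis by simp
qed

text \<open>Keeping the powers of the indeterminate on both sides makes the identity valid at 0 too,
  so agreement at all points gives equality of polynomials.\<close>

lemma det_S_pencil_eq_det_P_poly:
  assumes "M \<in> carrier_mat n n" "D \<in> carrier_mat n n" "G \<in> carrier_mat n r"
  shows "monom 1 n * det (S_pencil M D G) = smult ((- 1) ^ r) (monom 1 r * det (P_poly M D G))"
proof (rule poly_ext)
  fix z :: complex
  have "(- z) ^ r = (- 1) ^ r * z ^ r" by (rule power_minus)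
  thus "poly (monom 1 n * det (S_pencil M D G)) z = poly (smult ((- 1) ^ r) (monom 1 r * det (P_poly M D G))) z"
    using det_linearization[OF assms, of z] assms
    by (simp add: poly_det poly_monom eval_S_pencil eval_P_poly)
qed

lemma order_monom_nonzero: "z \<noteq> 0 \<Longrightarrow> Polynomial.order z (monom (1 :: complex) n) = 0"
  by (rule order_0I) (simp add: poly_monom)

text \<open>Comparing orders in \<open>det_S_pencil_eq_det_P_poly\<close>, the monomials contribute
  \<open>n\<close> and \<open>r\<close> at 0 and nothing elsewhere. The relation at 0 is additive to
  avoid truncated subtraction. The lemma serves both the original and the reduced
  coefficients.\<close>

lemma P_poly_spectrum:
  assumes carr: "M \<in> carrier_mat n n" "D \<in> carrier_mat n n" "G \<in> carrier_mat n r"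
    and S: "det (S_pencil M D G) \<noteq> 0"
  shows "det (P_poly M D G) \<noteq> 0"
    "alg_mult (P_poly M D G) 0 + r = alg_mult (S_pencil M D G) 0 + n"
    "\<And>z. z \<noteq> 0 \<Longrightarrow> alg_mult (P_poly M D G) z = alg_mult (S_pencil M D G) z"
    "eigvals (P_poly M D G) - {0} = eigvals (S_pencil M D G) - {0}"
proof -
  note eq = det_S_pencil_eq_det_P_poly[OF carr]
  have nz: "monom 1 n * det (S_pencil M D G) \<noteq> 0" using S by simp
  thus P: "det (P_poly M D G) \<noteq> 0" unfolding eq by auto
  have ord: "Polynomial.order z (monom 1 n) + alg_mult (S_pencil M D G) z =
    Polynomial.order z (monom 1 r) + alg_mult (P_poly M D G) z" for z
    using arg_cong[OF eq, of "Polynomial.order z"] nz P S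
    by (simp add: order_mult order_smult alg_mult_def)
  show "alg_mult (P_poly M D G) 0 + r = alg_mult (S_pencil M D G) 0 + n"
    using ord[of 0] by (simp add: order_0_monom)
  show *: "alg_mult (P_poly M D G) z = alg_mult (S_pencil M D G) z" if "z \<noteq> 0" for z
    using ord[of z] that by (simp add: order_monom_nonzero)
  show "eigvals (P_poly M D G) - {0} = eigvals (S_pencil M D G) - {0}"
    unfolding eigvals_eq_roots using * P S by (auto simp: alg_mult_def order_root)
qed

section \<open>Deflation of the common kernel of D and the adjoint of G\<close>

text \<open>The matrix \<open>[Q\<^sub>1 Q\<^sub>2]\<close> is merely invertible, not unitary; this lets the rank normal form of
  \<open>[D G]\<close> replace a QR factorization.\<close>

locale deflation =
  fixes n m k r :: nat and M D G Q1 Q2 :: "complex mat"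
  assumes n: "n = m + k"
    and M: "M \<in> carrier_mat n n" "pos_def M"
    and D: "D \<in> carrier_mat n n" "pos_semidef D"
    and G: "G \<in> carrier_mat n r"
    and G_inj: "\<And>y. y \<in> carrier_vec r \<Longrightarrow> G *\<^sub>v y = 0\<^sub>v n \<Longrightarrow> y = 0\<^sub>v r"
    and Q1: "Q1 \<in> carrier_mat n m" and Q2: "Q2 \<in> carrier_mat n k"
    and Q_det: "det (block_row Q1 Q2) \<noteq> 0"
    and DQ2: "D * Q2 = 0\<^sub>m n k"
    and GQ2: "mat_adjoint G * Q2 = 0\<^sub>m r k"
    and kernel_trivial: "\<And>x. x \<in> carrier_vec m \<Longrightarrow> D *\<^sub>v (Q1 *\<^sub>v x) = 0\<^sub>v n \<Longrightarrow>
      mat_adjoint G *\<^sub>v (Q1 *\<^sub>v x) = 0\<^sub>v r \<Longrightarrow> x = 0\<^sub>v m"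
begin

definition M11 where "M11 = mat_adjoint Q1 * (M * Q1)"
definition M12 where "M12 = mat_adjoint Q1 * (M * Q2)"
definition M22 where "M22 = mat_adjoint Q2 * (M * Q2)"
definition D11 where "D11 = mat_adjoint Q1 * (D * Q1)"
definition Gh where "Gh = mat_adjoint Q1 * G"
definition Mh where "Mh = schur_complement M11 M12 M22"
definition K where "K = the (mat_inverse M22) * mat_adjoint M12"
text \<open>The columns of \<open>Q1\<close> are corrected by combinations of columns of
  \<open>Q2\<close> so as to become orthogonal to the range of \<open>Q2\<close> in the inner
  product defined by \<open>M\<close>.\<close>

definition W where "W = Q1 - Q2 * K"
text \<open>\<open>H z\<close> and \<open>S z\<close> are values at a point, on which the block
  computations are done; \<open>eval_H\<close> and \<open>eval_S\<close> link them to the matrix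
  polynomials.\<close>

definition H where "H z = four_block_mat (z \<cdot>\<^sub>m Mh + D11) Gh (mat_adjoint Gh) (- (z \<cdot>\<^sub>m 1\<^sub>m r))"
definition S where "S z = four_block_mat (z \<cdot>\<^sub>m M + D) G (mat_adjoint G) (- (z \<cdot>\<^sub>m 1\<^sub>m r))"

lemma blocks_carrier:
  "M11 \<in> carrier_mat m m" "M12 \<in> carrier_mat m k" "M22 \<in> carrier_mat k k"
  "D11 \<in> carrier_mat m m" "Gh \<in> carrier_mat m r"
  unfolding M11_def M12_def M22_def D11_def Gh_def
  by (rule mult_carrier_mat mat_adjoint_carrier M(1) D(1) G Q1 Q2)+

lemma block_row_Q_carrier: "block_row Q1 Q2 \<in> carrier_mat n n"
  using block_row_carrier[OF Q1 Q2] n by simp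

lemma Q_inj:
  assumes "x \<in> carrier_vec m" "y \<in> carrier_vec k" "Q1 *\<^sub>v x + Q2 *\<^sub>v y = 0\<^sub>v n"
  shows "x = 0\<^sub>v m" "y = 0\<^sub>v k"
proof -
  have "x @\<^sub>v y \<in> carrier_vec n" using assms n by simp
  moreover have "block_row Q1 Q2 *\<^sub>v (x @\<^sub>v y) = 0\<^sub>v n"
    using block_row_mult_vec[OF Q1 Q2] assms by simp
  ultimately have "x @\<^sub>v y = 0\<^sub>v n" using Q_det det_nonzero_iff_inj[OF block_row_Q_carrier] by blast
  also have "0\<^sub>v n = 0\<^sub>v m @\<^sub>v (0\<^sub>v k :: complex vec)" using n by (intro eq_vecI) auto
  finally show "x = 0\<^sub>v m" "y = 0\<^sub>v k" using append_vec_eq[OF assms(1), of "0\<^sub>v m"] by simp_all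
qed

lemma Q2_inj: "y \<in> carrier_vec k \<Longrightarrow> Q2 *\<^sub>v y = 0\<^sub>v n \<Longrightarrow> y = 0\<^sub>v k"
  using Q_inj(2)[of "0\<^sub>v m" y] Q1 by simp

lemma M22: "pos_def M22" "det M22 \<noteq> 0"
proof -
  show "pos_def M22" unfolding M22_def by (rule pos_def_congruence[OF M Q2 Q2_inj])
  thus "det M22 \<noteq> 0" using pos_def_det_nonzero blocks_carrier(3) by blast
qed

lemma K: "K \<in> carrier_mat k m" "M22 * K = mat_adjoint M12"
proof -
  note i = mat_inverse_the[OF blocks_carrier(3) M22(2)]
  show "K \<in> carrier_mat k m" unfolding K_def using i(1) blocks_carrier(2) by simp
  show "M22 * K = mat_adjoint M12"
    unfolding K_def using i blocks_carrier(2)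
      assoc_mult_mat[OF blocks_carrier(3) i(1), of "mat_adjoint M12" m] by simp
qed

section \<open>Products with the elimination matrix\<close>

lemma W: "W \<in> carrier_mat n m"
  unfolding W_def using Q1 Q2 K by auto

lemma M_herm: "mat_adjoint M = M" and D_herm: "mat_adjoint D = D"
  using pos_defD(1)[OF M(2,1)] pos_semidefD(1)[OF D(2,1)] by auto

lemma adjoint_M12: "mat_adjoint M12 = mat_adjoint Q2 * (M * Q1)"
  using mat_adjoint_mult[of "mat_adjoint Q1" m n "M * Q2" k] mat_adjoint_mult[OF M(1) Q2]
    assoc_mult_mat[of "mat_adjoint Q2" k n M n Q1 m] Q1 Q2 M(1) M_herm by (simp add: M12_def)

lemma mult_W:
  assumes "A \<in> carrier_mat p n"
  shows "A * W = A * Q1 - (A * Q2) * K"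
  unfolding W_def using assms Q1 Q2 K(1)
    mult_minus_distrib_mat[OF assms Q1, of "Q2 * K"] assoc_mult_mat[OF assms Q2 K(1)] by simp

lemma adjoint_W_mult:
  assumes "A \<in> carrier_mat n p"
  shows "mat_adjoint W * A = mat_adjoint Q1 * A - mat_adjoint K * (mat_adjoint Q2 * A)"
proof -
  have "mat_adjoint W = mat_adjoint Q1 - mat_adjoint K * mat_adjoint Q2"
    unfolding W_def using mat_adjoint_minus[OF Q1, of "Q2 * K"] mat_adjoint_mult[OF Q2 K(1)] Q2 K(1) by simp
  moreover have "mat_adjoint K * mat_adjoint Q2 \<in> carrier_mat m n"
    by (rule mult_carrier_mat mat_adjoint_carrier K(1) Q2)+
  ultimately show ?thesis
    using minus_mult_distrib_mat[of "mat_adjoint Q1" m n "mat_adjoint K * mat_adjoint Q2" A p]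
      assoc_mult_mat[of "mat_adjoint K" m k "mat_adjoint Q2" n A p] assms Q1 Q2 K(1) by simp
qed

text \<open>The product expands to \<open>mat_adjoint M12 - M22 * K\<close>, and \<open>K\<close>
  solves exactly \<open>M22 * K = mat_adjoint M12\<close>.\<close>

lemma Q2_MW: "mat_adjoint Q2 * (M * W) = 0\<^sub>m k m"
proof -
  have "mat_adjoint Q2 * (M * W) = mat_adjoint Q2 * M * W"
    using assoc_mult_mat[of "mat_adjoint Q2" k n M n W m] M(1) Q2 W by simp
  also have "\<dots> = mat_adjoint Q2 * M * Q1 - mat_adjoint Q2 * M * Q2 * K"
    by (rule mult_W[of _ k]) (use M(1) Q2 in auto)
  also have "mat_adjoint Q2 * M * Q1 = mat_adjoint M12"
    using assoc_mult_mat[of "mat_adjoint Q2" k n M n Q1 m] M(1) Q2 Q1 adjoint_M12 by simp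
  also have "mat_adjoint Q2 * M * Q2 = M22"
    using assoc_mult_mat[of "mat_adjoint Q2" k n M n Q2 k] M(1) Q2 M22_def by simp
  finally show ?thesis using K(2) blocks_carrier(2) by simp
qed

lemma W_MQ2: "mat_adjoint W * (M * Q2) = 0\<^sub>m m k"
proof -
  have "mat_adjoint (mat_adjoint Q2 * (M * W)) = mat_adjoint W * (M * Q2)"
    using mat_adjoint_mult[of "mat_adjoint Q2" k n "M * W" m] mat_adjoint_mult[OF M(1) W]
      assoc_mult_mat[of "mat_adjoint W" m n M n Q2 k] M(1) Q2 W M_herm by simp
  thus ?thesis using Q2_MW by simp
qed

text \<open>By \<open>Q2_MW\<close> the left factor \<open>mat_adjoint W\<close> acts like
  \<open>mat_adjoint Q1\<close>, which leaves \<open>M11 - M12 * K\<close>, the Schur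
  complement.\<close>

lemma W_MW: "mat_adjoint W * (M * W) = Mh"
proof -
  have "mat_adjoint W * (M * W) = mat_adjoint Q1 * (M * W) - mat_adjoint K * (mat_adjoint Q2 * (M * W))"
    by (rule adjoint_W_mult) (use M(1) W in auto)
  also have "mat_adjoint K * (mat_adjoint Q2 * (M * W)) = 0\<^sub>m m m" unfolding Q2_MW using K(1) by simp
  also have "mat_adjoint Q1 * (M * W) = mat_adjoint Q1 * M * W"
    using assoc_mult_mat[of "mat_adjoint Q1" m n M n W m] M(1) Q1 W by simp
  also have "\<dots> = mat_adjoint Q1 * M * Q1 - mat_adjoint Q1 * M * Q2 * K"
    by (rule mult_W[of _ m]) (use M(1) Q1 in auto)
  also have "\<dots> = M11 - M12 * K"
    using assoc_mult_mat[of "mat_adjoint Q1" m n M n Q1 m] assoc_mult_mat[of "mat_adjoint Q1" m n M n Q2 k]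
      M(1) Q1 Q2 by (simp add: M11_def M12_def)
  also have "M12 * K = M12 * the (mat_inverse M22) * mat_adjoint M12"
    unfolding K_def using mat_inverse_the(1)[OF blocks_carrier(3) M22(2)] blocks_carrier(2)
      assoc_mult_mat[OF blocks_carrier(2), of "the (mat_inverse M22)" k "mat_adjoint M12" m] by simp
  finally show ?thesis using blocks_carrier by (auto simp: Mh_def schur_complement_def)
qed

lemma Q2_D: "mat_adjoint Q2 * D = 0\<^sub>m k n"
  using mat_adjoint_mult[OF D(1) Q2] D_herm DQ2 by simp

lemma Q2_G: "mat_adjoint Q2 * G = 0\<^sub>m k r"
  using mat_adjoint_mult[of "mat_adjoint G" r n Q2 k] G Q2 GQ2 by simp

text \<open>\<open>D\<close> annihilates the correction \<open>Q2 * K\<close>. So the elimination in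
  \<open>M\<close> leaves the blocks of \<open>D\<close>, and likewise those of \<open>G\<close>, as
  they are for \<open>Q1\<close>.\<close>

lemma D_W: "D * W = D * Q1"
  using mult_W[OF D(1)] K(1) mult_carrier_mat[OF D(1) Q1] by (simp add: DQ2)

lemma Q2_DW: "mat_adjoint Q2 * (D * W) = 0\<^sub>m k m"
  using assoc_mult_mat[of "mat_adjoint Q2" k n D n W m] Q2 D(1) W Q2_D by simp

lemma W_DW: "mat_adjoint W * (D * W) = D11"
proof -
  have "mat_adjoint W * (D * W) = mat_adjoint Q1 * (D * W) - mat_adjoint K * (mat_adjoint Q2 * (D * W))"
    by (rule adjoint_W_mult) (use D(1) W in auto)
  thus ?thesis unfolding Q2_DW using K(1) blocks_carrier(4) by (simp add: D_W D11_def)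
qed

lemma W_G: "mat_adjoint W * G = Gh"
  using adjoint_W_mult[OF G] K(1) minus_zero_mat[OF blocks_carrier(5)] by (simp add: Q2_G Gh_def)

lemma G_W: "mat_adjoint G * W = mat_adjoint Gh"
  using arg_cong[OF W_G, of mat_adjoint] mat_adjoint_mult[of "mat_adjoint W" m n G r] W G by simp

text \<open>\<open>[W Q2]\<close> is \<open>[Q1 Q2]\<close> times a unit triangular matrix: the
  vector \<open>W x + Q2 y\<close> equals \<open>Q1 x + Q2 (y - K x)\<close>.\<close>

lemma W_Q2_inj:
  assumes "x \<in> carrier_vec m" "y \<in> carrier_vec k" "W *\<^sub>v x + Q2 *\<^sub>v y = 0\<^sub>v n"
  shows "x = 0\<^sub>v m" "y = 0\<^sub>v k"
proof -
  have Kx: "K *\<^sub>v x \<in> carrier_vec k" using K(1) assms by simp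
  have "W *\<^sub>v x = Q1 *\<^sub>v x - Q2 *\<^sub>v (K *\<^sub>v x)"
    unfolding W_def using minus_mult_distrib_mat_vec[OF Q1, of "Q2 * K" x] Q2 K(1) assms(1)
      assoc_mult_mat_vec[OF Q2 K(1)] by simp
  hence "Q1 *\<^sub>v x + Q2 *\<^sub>v (y - K *\<^sub>v x) = W *\<^sub>v x + Q2 *\<^sub>v y"
    using mult_minus_distrib_mat_vec[OF Q2 assms(2) Kx] Q1 Q2 assms(1,2) Kx
    by (intro eq_vecI) auto
  hence *: "Q1 *\<^sub>v x + Q2 *\<^sub>v (y - K *\<^sub>v x) = 0\<^sub>v n" using assms(3) by simp
  show x: "x = 0\<^sub>v m" by (rule Q_inj(1)[OF assms(1) _ *]) (use Kx assms in auto)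
  have "y - K *\<^sub>v x = 0\<^sub>v k" by (rule Q_inj(2)[OF assms(1) _ *]) (use Kx assms in auto)
  thus "y = 0\<^sub>v k" using x K(1) assms(2) by simp
qed

lemma W_inj: "x \<in> carrier_vec m \<Longrightarrow> W *\<^sub>v x = 0\<^sub>v n \<Longrightarrow> x = 0\<^sub>v m"
  using W_Q2_inj(1)[of x "0\<^sub>v k"] Q2 by simp

section \<open>Positivity of the Schur complement and nonsingularity of H(0)\<close>

lemma pos_def_Mh: "pos_def Mh"
  using pos_def_congruence[OF M W W_inj] W_MW by simp

lemma Mh_carrier: "Mh \<in> carrier_mat m m"
  unfolding W_MW[symmetric] by (rule mult_carrier_mat mat_adjoint_carrier M(1) W)+

text \<open>Since \<open>mat_adjoint Q2 * G\<close> vanishes, \<open>Gh y = 0\<close> makes the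
  adjoint of \<open>[Q1 Q2]\<close> annihilate \<open>G y\<close>. That adjoint is nonsingular and
  \<open>G\<close> is injective.\<close>

lemma Gh_inj:
  assumes "y \<in> carrier_vec r" "Gh *\<^sub>v y = 0\<^sub>v m"
  shows "y = 0\<^sub>v r"
proof (rule G_inj[OF assms(1)])
  have Gy: "G *\<^sub>v y \<in> carrier_vec n" using G assms by simp
  have "mat_adjoint (block_row Q1 Q2) *\<^sub>v (G *\<^sub>v y) = (Gh *\<^sub>v y) @\<^sub>v ((mat_adjoint Q2 * G) *\<^sub>v y)"
    using mat_adjoint_block_row_mult_vec[OF Q1 Q2 Gy] Q1 Q2 G assms(1)
      assoc_mult_mat_vec[of "mat_adjoint Q1" m n G r y] assoc_mult_mat_vec[of "mat_adjoint Q2" k n G r y]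
    by (simp add: Gh_def)
  also have "\<dots> = 0\<^sub>v m @\<^sub>v 0\<^sub>v k" using assms Q2_G by simp
  also have "\<dots> = 0\<^sub>v n" using n by (intro eq_vecI) auto
  finally have "mat_adjoint (block_row Q1 Q2) *\<^sub>v (G *\<^sub>v y) = 0\<^sub>v n" .
  moreover have "det (mat_adjoint (block_row Q1 Q2)) \<noteq> 0"
    using det_mat_adjoint[OF block_row_Q_carrier] Q_det by simp
  ultimately show "G *\<^sub>v y = 0\<^sub>v n"
    using Gy det_nonzero_iff_inj[OF mat_adjoint_carrier[OF block_row_Q_carrier]] by blast
qed

lemma H_carrier: "H z \<in> carrier_mat (m + r) (m + r)"
  and S_carrier: "S z \<in> carrier_mat (n + r) (n + r)"
  unfolding H_def S_def using blocks_carrier Mh_carrier M(1) D(1) G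
  by (auto intro!: four_block_carrier_mat)

text \<open>A kernel vector \<open>(x, y)\<close> satisfies \<open>D11 x + Gh y = 0\<close>, and the
  adjoint of \<open>Gh\<close> annihilates \<open>x\<close>. Pairing the first equation with
  \<open>x\<close> removes \<open>Gh y\<close>, so the form of \<open>D\<close> vanishes at
  \<open>Q1 x\<close> and, by semidefiniteness, \<open>D Q1 x = 0\<close>. Now
  \<open>kernel_trivial\<close> gives \<open>x = 0\<close>, and injectivity of \<open>Gh\<close>
  gives \<open>y = 0\<close>.\<close>

lemma det_H_0: "det (H 0) \<noteq> 0"
  unfolding det_nonzero_iff_inj[OF H_carrier]
proof (intro ballI impI)
  fix v assume v: "v \<in> carrier_vec (m + r)" "H 0 *\<^sub>v v = 0\<^sub>v (m + r)"
  define x where "x = vec_first v m"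
  define y where "y = vec_last v r"
  have xy: "x \<in> carrier_vec m" "y \<in> carrier_vec r" "v = x @\<^sub>v y"
    using v(1) unfolding x_def y_def by simp_all
  note [simp] = blocks_carrier(4,5) mat_adjoint_carrier[OF blocks_carrier(5)]
  have Gx: "mat_adjoint Gh *\<^sub>v x \<in> carrier_vec r" "D11 *\<^sub>v x \<in> carrier_vec m" "Gh *\<^sub>v y \<in> carrier_vec m"
    by (rule mult_mat_vec_carrier mat_adjoint_carrier blocks_carrier(4,5) xy(1,2))+
  have "H 0 = four_block_mat D11 Gh (mat_adjoint Gh) (0\<^sub>m r r)"
  proof -
    have "0 \<cdot>\<^sub>m Mh = 0\<^sub>m m m" by (intro eq_matI) (use Mh_carrier in auto)
    moreover have "- (0 \<cdot>\<^sub>m 1\<^sub>m r) = (0\<^sub>m r r :: complex mat)" by (intro eq_matI) auto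
    ultimately show ?thesis unfolding H_def by simp
  qed
  hence "H 0 *\<^sub>v v = (D11 *\<^sub>v x + Gh *\<^sub>v y) @\<^sub>v (mat_adjoint Gh *\<^sub>v x + 0\<^sub>m r r *\<^sub>v y)"
    using four_block_mat_mult_vec[of D11 m m Gh r "mat_adjoint Gh" r "0\<^sub>m r r" x y] xy by simp
  moreover have "0\<^sub>v (m + r) = 0\<^sub>v m @\<^sub>v (0\<^sub>v r :: complex vec)" by (intro eq_vecI) auto
  ultimately have "(D11 *\<^sub>v x + Gh *\<^sub>v y) @\<^sub>v (mat_adjoint Gh *\<^sub>v x + 0\<^sub>m r r *\<^sub>v y) = 0\<^sub>v m @\<^sub>v 0\<^sub>v r"
    using v(2) by metis
  hence 1: "D11 *\<^sub>v x + Gh *\<^sub>v y = 0\<^sub>v m" and "mat_adjoint Gh *\<^sub>v x + 0\<^sub>m r r *\<^sub>v y = 0\<^sub>v r"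
    using append_vec_eq[of "D11 *\<^sub>v x + Gh *\<^sub>v y" m "0\<^sub>v m"] Gx by auto
  hence 2: "mat_adjoint Gh *\<^sub>v x = 0\<^sub>v r" using xy(2) Gx by simp
  have "(D11 *\<^sub>v x) \<bullet>c x + (Gh *\<^sub>v y) \<bullet>c x = (D11 *\<^sub>v x + Gh *\<^sub>v y) \<bullet>c x"
    using xy Gx by (simp add: add_scalar_prod_distrib[of _ m])
  also have "\<dots> = 0" unfolding 1 using xy by simp
  also have "(Gh *\<^sub>v y) \<bullet>c x = 0"
    using mult_mat_vec_cscalar[OF blocks_carrier(5) xy(2,1)] 2 xy by simp
  finally have "(D11 *\<^sub>v x) \<bullet>c x = 0" by simp
  hence "(D *\<^sub>v (Q1 *\<^sub>v x)) \<bullet>c (Q1 *\<^sub>v x) = 0"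
    using congruence_cscalar[OF D(1) Q1 xy(1)] by (simp add: D11_def)
  hence "D *\<^sub>v (Q1 *\<^sub>v x) = 0\<^sub>v n"
    using pos_semidef_kernel[OF D, of "Q1 *\<^sub>v x"] Q1 xy(1) by simp
  moreover have "mat_adjoint Gh = mat_adjoint G * Q1"
    unfolding Gh_def using mat_adjoint_mult[of "mat_adjoint Q1" m n G r] Q1 G by simp
  hence "mat_adjoint G *\<^sub>v (Q1 *\<^sub>v x) = 0\<^sub>v r"
    using 2 assoc_mult_mat_vec[of "mat_adjoint G" r n Q1 m x] G Q1 xy(1) by simp
  ultimately have x0: "x = 0\<^sub>v m" using kernel_trivial xy(1) by blast
  hence "Gh *\<^sub>v y = 0\<^sub>v m" using 1 Gx mult_mat_vec_zero[OF blocks_carrier(4)] by simp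
  hence "y = 0\<^sub>v r" using Gh_inj xy(2) by blast
  thus "v = 0\<^sub>v (m + r)" using xy(3) x0 by (intro eq_vecI) auto
qed

section \<open>The congruence with a block diagonal pencil\<close>

text \<open>The columns of \<open>X\<close> are ordered as \<open>U = diag(W, I)\<close> followed by
  \<open>V\<close>, which is \<open>Q2\<close> on top of a zero block. So the part giving
  \<open>H z\<close> comes first, and \<open>Q2\<close> contributes the decoupled block
  \<open>z M22\<close>. A single \<open>X\<close> serves all \<open>z\<close>.\<close>

lemma congruence:
  obtains X where "X \<in> carrier_mat (n + r) (n + r)" "det X \<noteq> 0"
    "\<forall>z. mat_adjoint X * (S z * X) =
      four_block_mat (H z) (0\<^sub>m (m + r) k) (0\<^sub>m k (m + r)) (z \<cdot>\<^sub>m M22)"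
proof -
  define U where "U = four_block_mat W (0\<^sub>m n r) (0\<^sub>m r m) (1\<^sub>m r)"
  \<comment> \<open>The right block column is empty; this form lets the products with
    \<open>V\<close> use the same block multiplication rule as those with \<open>U\<close>.\<close>
  define V where "V = four_block_mat Q2 (0\<^sub>m n 0) (0\<^sub>m r k) (0\<^sub>m r 0)"
  define X where "X = block_row U V"
  have U: "U \<in> carrier_mat (n + r) (m + r)" using W unfolding U_def by simp
  have V: "V \<in> carrier_mat (n + r) k" using four_block_carrier_mat[OF Q2, of "0\<^sub>m r 0" r 0] unfolding V_def by simp
  have X: "X \<in> carrier_mat (n + r) (n + r)"
    unfolding X_def using block_row_carrier[OF U V] n by (simp add: ac_simps)
  have adjU: "mat_adjoint U = four_block_mat (mat_adjoint W) (0\<^sub>m m r) (0\<^sub>m r n) (1\<^sub>m r)"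
    unfolding U_def using W by (subst mat_adjoint_four_block) auto
  have adjV: "mat_adjoint V = four_block_mat (mat_adjoint Q2) (0\<^sub>m k r) (0\<^sub>m 0 n) (0\<^sub>m 0 r)"
    unfolding V_def using Q2 by (subst mat_adjoint_four_block) auto
  \<comment> \<open>Splitting a kernel vector as \<open>(x, y, w)\<close>, the upper rows give
    \<open>W x + Q2 w = 0\<close> and the lower rows give \<open>y = 0\<close>.\<close>
  have "det X \<noteq> 0" unfolding det_nonzero_iff_inj[OF X]
  proof (intro ballI impI)
    fix v assume v: "v \<in> carrier_vec (n + r)" "X *\<^sub>v v = 0\<^sub>v (n + r)"
    define u where "u = vec_first v (m + r)"
    define w where "w = vec_last v k"
    define x where "x = vec_first u m"
    define y where "y = vec_last u r"
    have v': "v \<in> carrier_vec ((m + r) + k)" using v(1) n by (simp add: ac_simps)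
    have uw: "u \<in> carrier_vec (m + r)" "w \<in> carrier_vec k" "v = u @\<^sub>v w"
      using v' unfolding u_def w_def by (simp_all del: add.assoc)
    have xy: "x \<in> carrier_vec m" "y \<in> carrier_vec r" "u = x @\<^sub>v y"
      using uw(1) unfolding x_def y_def by simp_all
    have Wx: "W *\<^sub>v x \<in> carrier_vec n" "Q2 *\<^sub>v w \<in> carrier_vec n" using W Q2 xy uw by auto
    have "U *\<^sub>v u = (W *\<^sub>v x) @\<^sub>v y"
      unfolding U_def xy(3) using four_block_mat_mult_vec[OF W, of "0\<^sub>m n r" r "0\<^sub>m r m" r "1\<^sub>m r" x y] W xy
      by simp
    moreover have "V *\<^sub>v w = (Q2 *\<^sub>v w) @\<^sub>v 0\<^sub>v r"
      unfolding V_def using Q2 uw(2) by (intro eq_vecI) (auto simp: scalar_prod_def)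
    ultimately have "X *\<^sub>v v = (W *\<^sub>v x + Q2 *\<^sub>v w) @\<^sub>v (y + 0\<^sub>v r)"
      unfolding X_def uw(3) block_row_mult_vec[OF U V uw(1,2)]
      using append_vec_add[OF Wx, of y r "0\<^sub>v r"] xy by simp
    hence "X *\<^sub>v v = (W *\<^sub>v x + Q2 *\<^sub>v w) @\<^sub>v y" using xy(2) by simp
    moreover have "0\<^sub>v (n + r) = 0\<^sub>v n @\<^sub>v (0\<^sub>v r :: complex vec)" by (intro eq_vecI) auto
    ultimately have "(W *\<^sub>v x + Q2 *\<^sub>v w) @\<^sub>v y = 0\<^sub>v n @\<^sub>v 0\<^sub>v r" using v(2) by metis
    hence *: "W *\<^sub>v x + Q2 *\<^sub>v w = 0\<^sub>v n" "y = 0\<^sub>v r"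
      using append_vec_eq[of "W *\<^sub>v x + Q2 *\<^sub>v w" n "0\<^sub>v n"] Wx by auto
    thus "v = 0\<^sub>v (n + r)"
      using W_Q2_inj[OF xy(1) uw(2)] xy uw n by (intro eq_vecI) auto
  qed
  moreover have "mat_adjoint X * (S z * X) =
      four_block_mat (H z) (0\<^sub>m (m + r) k) (0\<^sub>m k (m + r)) (z \<cdot>\<^sub>m M22)" for z
  proof -
    define A where "A = z \<cdot>\<^sub>m M + D"
    have A: "A \<in> carrier_mat n n" using M(1) D(1) by (simp add: A_def)
    have AW: "A * W = z \<cdot>\<^sub>m (M * W) + D * W"
      unfolding A_def using add_mult_distrib_mat[of "z \<cdot>\<^sub>m M" n n D W m] mult_smult_assoc_mat[OF M(1) W] M(1) D(1) W by simp
    have AQ2: "A * Q2 = z \<cdot>\<^sub>m (M * Q2)"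
      unfolding A_def using add_mult_distrib_mat[of "z \<cdot>\<^sub>m M" n n D Q2 k] mult_smult_assoc_mat[OF M(1) Q2]
        M(1) D(1) Q2 DQ2 by simp
    have MW: "M * W \<in> carrier_mat n m" and DW: "D * W \<in> carrier_mat n m" and MQ2: "M * Q2 \<in> carrier_mat n k"
      using M(1) D(1) W Q2 by auto
    have W_AW: "mat_adjoint W * (A * W) = z \<cdot>\<^sub>m Mh + D11"
      unfolding AW using mult_add_distrib_mat[of "mat_adjoint W" m n "z \<cdot>\<^sub>m (M * W)" m "D * W"]
        mult_smult_distrib[of "mat_adjoint W" m n "M * W" m z] W MW DW by (simp add: W_MW W_DW)
    have Q2_AW: "mat_adjoint Q2 * (A * W) = 0\<^sub>m k m"
      unfolding AW using mult_add_distrib_mat[of "mat_adjoint Q2" k n "z \<cdot>\<^sub>m (M * W)" m "D * W"]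
        mult_smult_distrib[of "mat_adjoint Q2" k n "M * W" m z] Q2 MW DW by (simp add: Q2_MW Q2_DW)
    have W_AQ2: "mat_adjoint W * (A * Q2) = 0\<^sub>m m k"
      unfolding AQ2 using mult_smult_distrib[of "mat_adjoint W" m n "M * Q2" k z] W MQ2 by (simp add: W_MQ2)
    have Q2_AQ2: "mat_adjoint Q2 * (A * Q2) = z \<cdot>\<^sub>m M22"
      unfolding AQ2 using mult_smult_distrib[of "mat_adjoint Q2" k n "M * Q2" k z] Q2 MQ2 by (simp add: M22_def)
    have SU: "S z * U = four_block_mat (A * W) G (mat_adjoint Gh) (- (z \<cdot>\<^sub>m 1\<^sub>m r))"
      unfolding S_def U_def A_def[symmetric]
      by (subst mult_four_block_mat[of _ n n _ r _ r _ _ m _ r]) (use A G W G_W in auto)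
    have SV: "S z * V = four_block_mat (A * Q2) (0\<^sub>m n 0) (0\<^sub>m r k) (0\<^sub>m r 0)"
      unfolding S_def V_def A_def[symmetric]
      by (subst mult_four_block_mat[of _ n n _ r _ r _ _ k _ 0]) (use A G Q2 GQ2 in auto)
    have "- 0\<^sub>m m r = (0\<^sub>m m r :: complex mat)" "- 0\<^sub>m k r = (0\<^sub>m k r :: complex mat)"
      by (intro eq_matI; simp)+
    note carr = this A W Q2 G blocks_carrier mat_adjoint_carrier[OF blocks_carrier(5)] Mh_carrier
      mult_carrier_mat[OF A W] mult_carrier_mat[OF A Q2]
    have "mat_adjoint U * (S z * U) = H z"
      unfolding SU adjU H_def
      by (subst mult_four_block_mat[of _ m n _ r _ r _ _ m _ r]) (use carr in \<open>auto simp: W_AW W_G\<close>)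
    moreover have "mat_adjoint U * (S z * V) = 0\<^sub>m (m + r) k"
      unfolding SV adjU
      by (subst mult_four_block_mat[of _ m n _ r _ r _ _ k _ 0]) (use carr in \<open>auto simp: W_AQ2\<close>)
    moreover have "mat_adjoint V * (S z * U) = 0\<^sub>m k (m + r)"
      unfolding SU adjV
      by (subst mult_four_block_mat[of _ k n _ r _ 0 _ _ m _ r]) (use carr in \<open>auto simp: Q2_AW Q2_G\<close>)
    moreover have "mat_adjoint V * (S z * V) = z \<cdot>\<^sub>m M22"
      unfolding SV adjV
      by (subst mult_four_block_mat[of _ k n _ r _ 0 _ _ k _ 0]) (use carr in \<open>auto simp: Q2_AQ2 intro!: eq_matI\<close>)
    moreover have "mat_adjoint X * (S z * X) = four_block_mat (mat_adjoint U * (S z * U))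
        (mat_adjoint U * (S z * V)) (mat_adjoint V * (S z * U)) (mat_adjoint V * (S z * V))"
      unfolding X_def mult_block_row[OF S_carrier U V]
      by (rule mat_adjoint_block_row_mult[OF U V])
        (rule mult_carrier_mat[OF S_carrier U] mult_carrier_mat[OF S_carrier V])+
    ultimately show ?thesis by simp
  qed
  ultimately show ?thesis using that[OF X] by blast
qed

section \<open>Spectra and multiplicities of the pencils and quadratic polynomials\<close>

lemma eval_S: "eval_matpoly (S_pencil M D G) z = S z"
  and eval_H: "eval_matpoly (H_pencil Mh D11 Gh) z = H z"
  and eval_S_hat: "eval_matpoly (S_pencil Mh D11 Gh) z = H z"
  unfolding S_def H_def
  by (rule eval_S_pencil[OF M(1) D(1) G] eval_H_pencil[OF Mh_carrier blocks_carrier(4,5)]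
      eval_S_pencil[OF Mh_carrier blocks_carrier(4,5)])+

text \<open>\<open>H_pencil\<close> and \<open>S_pencil\<close> on the reduced coefficients have the
  same values. So \<open>P_poly_spectrum\<close>, stated for \<open>S_pencil\<close>, relates the
  reduced quadratic polynomial to \<open>H_pencil\<close>.\<close>

lemma det_S_hat: "det (S_pencil Mh D11 Gh) = det (H_pencil Mh D11 Gh)"
  by (rule poly_ext) (simp add: poly_det eval_H eval_S_hat)

text \<open>Determinants are taken in \<open>congruence\<close>: the constant is
  \<open>det M22\<close> divided by the squared modulus of \<open>det X\<close>, and
  \<open>z M22\<close> contributes the power \<open>z^k\<close>.\<close>

lemma det_S_pencil:
  obtains c where "c \<noteq> 0" "det (S_pencil M D G) = smult c (monom 1 k * det (H_pencil Mh D11 Gh))"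
proof -
  obtain X where X: "X \<in> carrier_mat (n + r) (n + r)" "det X \<noteq> 0"
    "\<forall>z. mat_adjoint X * (S z * X) =
      four_block_mat (H z) (0\<^sub>m (m + r) k) (0\<^sub>m k (m + r)) (z \<cdot>\<^sub>m M22)"
    by (rule congruence)
  have "cnj (det X) * (poly (det (S_pencil M D G)) z * det X) =
    poly (det (H_pencil Mh D11 Gh)) z * (z ^ k * det M22)" for z
  proof -
    have "det (mat_adjoint X * (S z * X)) = cnj (det X) * (det (S z) * det X)"
      using X(1) S_carrier[of z] det_mult[of "mat_adjoint X" "n + r" "S z * X"] det_mult[OF S_carrier X(1)]
      by (simp add: det_mat_adjoint)
    moreover have "det (mat_adjoint X * (S z * X)) = det (H z) * det (z \<cdot>\<^sub>m M22)"
      unfolding X(3)[rule_format] by (rule det_four_block_mat_lower_left_zero[of _ "m + r" _ k]) (use H_carrier blocks_carrier in auto)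
    ultimately show ?thesis using blocks_carrier(3) by (simp add: poly_det eval_S eval_H)
  qed
  hence "poly (det (S_pencil M D G)) z =
    poly (smult (det M22 / (cnj (det X) * det X)) (monom 1 k * det (H_pencil Mh D11 Gh))) z" for z
    using X(2) by (simp add: poly_monom field_simps)
  hence "det (S_pencil M D G) =
    smult (det M22 / (cnj (det X) * det X)) (monom 1 k * det (H_pencil Mh D11 Gh))"
    by (intro poly_ext)
  thus ?thesis using that X(2) M22(2) by (metis divide_eq_0_iff mult_eq_0_iff complex_cnj_zero_iff)
qed

lemma H_pencil_0: "poly (det (H_pencil Mh D11 Gh)) 0 \<noteq> 0"
  using det_H_0 by (simp add: poly_det eval_H)

lemma det_pencils_nonzero: "det (H_pencil Mh D11 Gh) \<noteq> 0" "det (S_pencil M D G) \<noteq> 0"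
proof -
  show "det (H_pencil Mh D11 Gh) \<noteq> 0" using H_pencil_0 by auto
  thus "det (S_pencil M D G) \<noteq> 0" using det_S_pencil by (metis mult_eq_0_iff monom_eq_0_iff smult_eq_0_iff zero_neq_one)
qed

text \<open>The extra factor \<open>monom 1 k\<close> can only affect the point 0, which is not an
  eigenvalue of \<open>H_pencil\<close>.\<close>

lemma eigvals_H: "eigvals (H_pencil Mh D11 Gh) = eigvals (S_pencil M D G) - {0}"
proof -
  obtain c where "c \<noteq> 0" "det (S_pencil M D G) = smult c (monom 1 k * det (H_pencil Mh D11 Gh))"
    by (rule det_S_pencil)
  thus ?thesis using H_pencil_0 by (auto simp: eigvals_eq_roots poly_monom)
qed

lemma alg_mult_S_0: "alg_mult (S_pencil M D G) 0 = k"
proof -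
  obtain c where "c \<noteq> 0" "det (S_pencil M D G) = smult c (monom 1 k * det (H_pencil Mh D11 Gh))"
    by (rule det_S_pencil)
  moreover have "Polynomial.order 0 (det (H_pencil Mh D11 Gh)) = 0" using H_pencil_0 by (rule order_0I)
  ultimately show ?thesis using det_pencils_nonzero(1)
    by (simp add: alg_mult_def order_smult order_mult order_0_monom)
qed

text \<open>The leading coefficient \<open>diag(M, -I)\<close> of the pencil is nonsingular, so
  \<open>det_pencil_degree\<close> applies with size \<open>n + r\<close>.\<close>

lemma degree_S: "degree (det (S_pencil M D G)) = n + r"
proof -
  let ?A = "four_block_mat M (0\<^sub>m n r) (0\<^sub>m r n) (- 1\<^sub>m r)"
  let ?B = "four_block_mat D G (mat_adjoint G) (0\<^sub>m r r)"
  have "det ?A = det M * det (- 1\<^sub>m r)"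
    by (rule det_four_block_mat_lower_left_zero[of _ n _ r]) (use M(1) in auto)
  moreover have "- 1\<^sub>m r = (- 1) \<cdot>\<^sub>m (1\<^sub>m r :: complex mat)" by (intro eq_matI) auto
  hence "det (- 1\<^sub>m r :: complex mat) \<noteq> 0" by simp
  ultimately have "det ?A \<noteq> 0" using pos_def_det_nonzero[OF M] by simp
  moreover have "S z = z \<cdot>\<^sub>m ?A + ?B" for z
    unfolding S_def using M(1) D(1) G by (intro eq_matI) auto
  ultimately show ?thesis
    using M(1) D(1) by (intro det_pencil_degree[of ?A _ ?B]) (auto simp: poly_det eval_S)
qed

lemma sum_alg_mult_S: "(\<Sum>\<mu>\<in>eigvals (S_pencil M D G) - {0}. alg_mult (S_pencil M D G) \<mu>) = n + r - k"
  using sum_order_nonzero_roots[OF det_pencils_nonzero(2)] degree_S alg_mult_S_0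
  by (simp add: eigvals_eq_roots alg_mult_def)

lemmas P_spectrum = P_poly_spectrum[OF M(1) D(1) G det_pencils_nonzero(2)]

lemma sum_alg_mult_P: "(\<Sum>\<mu>\<in>eigvals (P_poly M D G) - {0}. alg_mult (P_poly M D G) \<mu>) = n + r - k"
  unfolding sum_alg_mult_S[symmetric] P_spectrum(4) by (rule sum.cong) (auto simp: P_spectrum(3))

lemmas P_hat_spectrum =
  P_poly_spectrum[OF Mh_carrier blocks_carrier(4,5), unfolded det_S_hat, OF det_pencils_nonzero(1)]

lemma eigvals_P_hat: "eigvals (P_poly Mh D11 Gh) - {0} = eigvals (H_pencil Mh D11 Gh)"
  using P_hat_spectrum(4) eigvals_H by (auto simp: eigvals_eq_roots det_S_hat)

text \<open>At 0 the reduced polynomial equals \<open>Gh * mat_adjoint Gh\<close>. For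
  \<open>m = r\<close> the injective matrix \<open>Gh\<close> is square, hence nonsingular, and 0 is
  not an eigenvalue.\<close>

lemma eigvals_P_hat_square:
  assumes "m = r"
  shows "eigvals (P_poly Mh D11 Gh) = eigvals (H_pencil Mh D11 Gh)"
proof -
  have Gh: "Gh \<in> carrier_mat r r" using blocks_carrier(5) assms by simp
  have "eval_matpoly (P_poly Mh D11 Gh) 0 = Gh * mat_adjoint Gh"
    unfolding eval_P_poly[OF Mh_carrier blocks_carrier(4,5)]
    by (intro eq_matI) (use Mh_carrier blocks_carrier(4,5) in auto)
  hence "det (eval_matpoly (P_poly Mh D11 Gh) 0) = det Gh * cnj (det Gh)"
    using det_mult[OF Gh, of "mat_adjoint Gh"] Gh by (simp add: det_mat_adjoint)
  moreover have "det Gh \<noteq> 0" using det_nonzero_iff_inj[OF Gh] Gh_inj[unfolded assms] by blast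
  ultimately have "0 \<notin> eigvals (P_poly Mh D11 Gh)" by (simp add: eigvals_def)
  thus ?thesis using eigvals_P_hat by blast
qed

lemma invertible_congruence:
  "\<exists>X \<in> carrier_mat (n + r) (n + r). invertible_mat X \<and>
     mat_adjoint X * eval_matpoly (S_pencil M D G) z * X =
       diag_block_mat [eval_matpoly (H_pencil Mh D11 Gh) z, z \<cdot>\<^sub>m M22]"
proof -
  obtain X where X: "X \<in> carrier_mat (n + r) (n + r)" "det X \<noteq> 0"
    "\<forall>z. mat_adjoint X * (S z * X) =
      four_block_mat (H z) (0\<^sub>m (m + r) k) (0\<^sub>m k (m + r)) (z \<cdot>\<^sub>m M22)"
    by (rule congruence)
  have "invertible_mat X"
    using mat_inverse_the[OF X(1,2)] X(1)
    by (auto simp: invertible_mat_def inverts_mat_def intro!: exI[of _ "the (mat_inverse X)"])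
  moreover have "mat_adjoint X * S z * X = mat_adjoint X * (S z * X)"
    by (rule assoc_mult_mat[OF mat_adjoint_carrier[OF X(1)] S_carrier X(1)])
  \<comment> \<open>The recursion of \<open>diag_block_mat\<close> ends with an empty block, so the
    two sides are compared entrywise.\<close>
  moreover have "diag_block_mat [H z, z \<cdot>\<^sub>m M22] =
    four_block_mat (H z) (0\<^sub>m (m + r) k) (0\<^sub>m k (m + r)) (z \<cdot>\<^sub>m M22)"
    using H_carrier[of z] blocks_carrier(3) by (intro eq_matI) (auto simp: Let_def)
  ultimately show ?thesis using X(1,3) by (metis eval_S eval_H)
qed

end

section \<open>Application to the rank normal form and to a QR factorization\<close>

theorem theorem10:
  fixes n r k :: nat and M D G :: "complex mat"
  assumes M: "M \<in> carrier_mat n n" "pos_def M"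
    and D: "D \<in> carrier_mat n n" "pos_semidef D"
    and G: "G \<in> carrier_mat n r" "vec_space.rank n G = r"
    and k: "1 \<le> k" "k \<le> n"
    and rank_DG: "vec_space.rank n (block_row D G) = n - k"
  shows
    "(regular_matpoly (S_pencil M D G) \<and> regular_matpoly (P_poly M D G) \<and>
      (\<Sum>\<mu>\<in>eigvals (S_pencil M D G) - {0}. alg_mult (S_pencil M D G) \<mu>) = n + r - k \<and>
      (\<Sum>\<mu>\<in>eigvals (P_poly M D G) - {0}. alg_mult (P_poly M D G) \<mu>) = n + r - k \<and>
      0 \<in> eigvals (S_pencil M D G) \<and> alg_mult (S_pencil M D G) 0 = k \<and>
      0 \<in> eigvals (P_poly M D G) \<and> alg_mult (P_poly M D G) 0 = n + k - r)
     \<and>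
     (\<forall>Q Q1 Q2 Dh Gh D11 M11 M12 M22 Mh.
        Q1 \<in> carrier_mat n (n - k) \<and> Q2 \<in> carrier_mat n k \<and>
        Q = block_row Q1 Q2 \<and> unitary_mat n Q \<and>
        Dh \<in> carrier_mat (n - k) n \<and> Gh \<in> carrier_mat (n - k) r \<and>
        mat_adjoint Q * block_row D G = four_block_mat Dh Gh (0\<^sub>m k n) (0\<^sub>m k r) \<and>
        vec_space.rank (n - k) (block_row Dh Gh) = n - k \<and>
        D11 = mat_adjoint Q1 * D * Q1 \<and>
        M11 \<in> carrier_mat (n - k) (n - k) \<and> M12 \<in> carrier_mat (n - k) k \<and>
        M22 \<in> carrier_mat k k \<and>
        mat_adjoint Q * M * Q = four_block_mat M11 M12 (mat_adjoint M12) M22 \<and>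
        Mh = schur_complement M11 M12 M22
        \<longrightarrow>
        pos_def Mh \<and>
        (\<forall>z::complex. \<exists>X \<in> carrier_mat (n + r) (n + r). invertible_mat X \<and>
           mat_adjoint X * eval_matpoly (S_pencil M D G) z * X
             = diag_block_mat [eval_matpoly (H_pencil Mh D11 Gh) z, z \<cdot>\<^sub>m M22]) \<and>
        regular_matpoly (H_pencil Mh D11 Gh) \<and> regular_matpoly (P_poly Mh D11 Gh) \<and>
        eigvals (P_poly Mh D11 Gh) - {0} = eigvals (H_pencil Mh D11 Gh) \<and>
        eigvals (H_pencil Mh D11 Gh) = eigvals (S_pencil M D G) - {0} \<and>
        eigvals (S_pencil M D G) - {0} = eigvals (P_poly M D G) - {0} \<and>
        (n = k + r \<longrightarrow>
           eigvals (P_poly Mh D11 Gh) = eigvals (H_pencil Mh D11 Gh) \<and>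
           eigvals (H_pencil Mh D11 Gh) = eigvals (S_pencil M D G) - {0} \<and>
           eigvals (S_pencil M D G) - {0} = eigvals (P_poly M D G) - {0}))"
proof (rule conjI)
  have DG: "block_row D G \<in> carrier_mat n (n + r)" using block_row_carrier[OF D(1) G(1)] .
  have D_herm: "mat_adjoint D = D" using pos_semidefD(1)[OF D(2,1)] .
  \<comment> \<open>With \<open>r <= n\<close> the truncated difference \<open>n + k - r\<close> is
    a genuine one and is at least \<open>k\<close>, hence positive.\<close>
  have rn: "r \<le> n" using rank_normal_form[OF G] by metis
  note G_inj = full_col_rank_inj[OF G]
  \<comment> \<open>Statement (a) does not mention \<open>Q\<close>, so the merely invertible matrix
    of the rank normal form can be used for it.\<close>
  obtain Q1 Q2 Y where Q: "Q1 \<in> carrier_mat n (n - k)" "Q2 \<in> carrier_mat n (n - (n - k))"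
    and Y: "Y \<in> carrier_mat (n + r) (n - k)" and det: "det (block_row Q1 Q2) \<noteq> 0"
    and inv: "mat_adjoint Q1 * (block_row D G * Y) = 1\<^sub>m (n - k)"
    and zero: "mat_adjoint Q2 * block_row D G = 0\<^sub>m (n - (n - k)) (n + r)"
    by (rule rank_normal_form[OF DG rank_DG])
  \<comment> \<open>The column count \<open>n - (n - k)\<close> is \<open>k\<close> because
    \<open>k <= n\<close>.\<close>
  have Q2: "Q2 \<in> carrier_mat n k" using Q(2) k by simp
  have c: "mat_adjoint Q2 * D \<in> carrier_mat k n" "mat_adjoint Q2 * G \<in> carrier_mat k r"
    by (rule mult_carrier_mat mat_adjoint_carrier Q2 D(1) G(1))+
  have "block_row (mat_adjoint Q2 * D) (mat_adjoint Q2 * G) = block_row (0\<^sub>m k n) (0\<^sub>m k r)"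
    using zero k mult_block_row[of "mat_adjoint Q2" k n D n G r] Q2 D(1) G(1)
    by (simp add: block_row_def)
  note zeros = block_row_inj[OF this c(1) zero_carrier_mat c(2) zero_carrier_mat]
  have adj: "mat_adjoint (mat_adjoint Q2 * D) = D * Q2" "mat_adjoint (mat_adjoint Q2 * G) = mat_adjoint G * Q2"
    using mat_adjoint_mult[of "mat_adjoint Q2" k n D n] mat_adjoint_mult[of "mat_adjoint Q2" k n G r]
      D_herm Q2 D(1) G(1) by simp_all
  interpret deflation n "n - k" k r M D G Q1 Q2
  proof
    show "D * Q2 = 0\<^sub>m n k" "mat_adjoint G * Q2 = 0\<^sub>m r k"
      unfolding adj[symmetric] zeros by simp_all
    fix x assume x: "x \<in> carrier_vec (n - k)" "D *\<^sub>v (Q1 *\<^sub>v x) = 0\<^sub>v n" "mat_adjoint G *\<^sub>v (Q1 *\<^sub>v x) = 0\<^sub>v r"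
    have Q1x: "Q1 *\<^sub>v x \<in> carrier_vec n" using Q(1) x(1) by simp
    have "mat_adjoint (block_row D G) *\<^sub>v (Q1 *\<^sub>v x) = 0\<^sub>v n @\<^sub>v 0\<^sub>v r"
      using mat_adjoint_block_row_mult_vec[OF D(1) G(1) Q1x] x D_herm by simp
    also have "\<dots> = 0\<^sub>v (n + r)" by (intro eq_vecI) auto
    finally have 0: "mat_adjoint (block_row D G) *\<^sub>v (Q1 *\<^sub>v x) = 0\<^sub>v (n + r)" .
    have "1\<^sub>m (n - k) = mat_adjoint (mat_adjoint Q1 * (block_row D G * Y))" using inv by simp
    also have "\<dots> = mat_adjoint Y * mat_adjoint (block_row D G) * Q1"
      using mat_adjoint_mult[of "mat_adjoint Q1" "n - k" n "block_row D G * Y" "n - k"]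
        mat_adjoint_mult[OF DG Y] Q(1) DG Y by simp
    \<comment> \<open>The adjoint of \<open>inv\<close> exhibits \<open>mat_adjoint Y\<close> as a
      left inverse of \<open>mat_adjoint (block_row D G) * Q1\<close>, so \<open>x\<close> vanishes
      as soon as its image under that product does.\<close>
    finally have "x = (mat_adjoint Y * mat_adjoint (block_row D G) * Q1) *\<^sub>v x"
      using one_mult_mat_vec[OF x(1)] by simp
    also have "\<dots> = (mat_adjoint Y * mat_adjoint (block_row D G)) *\<^sub>v (Q1 *\<^sub>v x)"
      using assoc_mult_mat_vec[of "mat_adjoint Y * mat_adjoint (block_row D G)" "n - k" n Q1 "n - k" x]
        Q(1) x(1) mult_carrier_mat[OF mat_adjoint_carrier[OF Y] mat_adjoint_carrier[OF DG]] by simp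
    also have "\<dots> = mat_adjoint Y *\<^sub>v (mat_adjoint (block_row D G) *\<^sub>v (Q1 *\<^sub>v x))"
      by (rule assoc_mult_mat_vec[OF mat_adjoint_carrier[OF Y] mat_adjoint_carrier[OF DG] Q1x])
    also have "\<dots> = 0\<^sub>v (n - k)" unfolding 0 by (rule mult_mat_vec_zero[OF mat_adjoint_carrier[OF Y]])
    finally show "x = 0\<^sub>v (n - k)" .
  qed (use k M D G Q Q2 det G_inj in auto)
  have sq: "square_mat (S_pencil M D G)" "square_mat (P_poly M D G)"
    using M(1) D(1) G(1) by (auto simp: S_pencil_def P_poly_def)
  have multP: "alg_mult (P_poly M D G) 0 = n + k - r" using P_spectrum(2) alg_mult_S_0 by simp
  have pos: "0 < alg_mult (S_pencil M D G) 0" "0 < alg_mult (P_poly M D G) 0"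
    using alg_mult_S_0 multP k rn by auto
  have "0 \<in> eigvals (S_pencil M D G)" "0 \<in> eigvals (P_poly M D G)"
    using pos det_pencils_nonzero(2) P_spectrum(1)
    by (auto simp: eigvals_eq_roots alg_mult_def order_root)
  thus "regular_matpoly (S_pencil M D G) \<and> regular_matpoly (P_poly M D G) \<and>
      (\<Sum>\<mu>\<in>eigvals (S_pencil M D G) - {0}. alg_mult (S_pencil M D G) \<mu>) = n + r - k \<and>
      (\<Sum>\<mu>\<in>eigvals (P_poly M D G) - {0}. alg_mult (P_poly M D G) \<mu>) = n + r - k \<and>
      0 \<in> eigvals (S_pencil M D G) \<and> alg_mult (S_pencil M D G) 0 = k \<and>
      0 \<in> eigvals (P_poly M D G) \<and> alg_mult (P_poly M D G) 0 = n + k - r"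
    using sq det_pencils_nonzero(2) P_spectrum(1) sum_alg_mult_S sum_alg_mult_P alg_mult_S_0 multP
    by (simp add: regular_matpoly_def)
next
  have D_herm: "mat_adjoint D = D" using pos_semidefD(1)[OF D(2,1)] .
  note G_inj = full_col_rank_inj[OF G]
  show "\<forall>Q Q1 Q2 Dh Gh D11 M11 M12 M22 Mh.
        Q1 \<in> carrier_mat n (n - k) \<and> Q2 \<in> carrier_mat n k \<and>
        Q = block_row Q1 Q2 \<and> unitary_mat n Q \<and>
        Dh \<in> carrier_mat (n - k) n \<and> Gh \<in> carrier_mat (n - k) r \<and>
        mat_adjoint Q * block_row D G = four_block_mat Dh Gh (0\<^sub>m k n) (0\<^sub>m k r) \<and>
        vec_space.rank (n - k) (block_row Dh Gh) = n - k \<and>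
        D11 = mat_adjoint Q1 * D * Q1 \<and>
        M11 \<in> carrier_mat (n - k) (n - k) \<and> M12 \<in> carrier_mat (n - k) k \<and>
        M22 \<in> carrier_mat k k \<and>
        mat_adjoint Q * M * Q = four_block_mat M11 M12 (mat_adjoint M12) M22 \<and>
        Mh = schur_complement M11 M12 M22
        \<longrightarrow>
        pos_def Mh \<and>
        (\<forall>z::complex. \<exists>X \<in> carrier_mat (n + r) (n + r). invertible_mat X \<and>
           mat_adjoint X * eval_matpoly (S_pencil M D G) z * X
             = diag_block_mat [eval_matpoly (H_pencil Mh D11 Gh) z, z \<cdot>\<^sub>m M22]) \<and>
        regular_matpoly (H_pencil Mh D11 Gh) \<and> regular_matpoly (P_poly Mh D11 Gh) \<and>
        eigvals (P_poly Mh D11 Gh) - {0} = eigvals (H_pencil Mh D11 Gh) \<and>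
        eigvals (H_pencil Mh D11 Gh) = eigvals (S_pencil M D G) - {0} \<and>
        eigvals (S_pencil M D G) - {0} = eigvals (P_poly M D G) - {0} \<and>
        (n = k + r \<longrightarrow>
           eigvals (P_poly Mh D11 Gh) = eigvals (H_pencil Mh D11 Gh) \<and>
           eigvals (H_pencil Mh D11 Gh) = eigvals (S_pencil M D G) - {0} \<and>
           eigvals (S_pencil M D G) - {0} = eigvals (P_poly M D G) - {0})"
  proof (intro allI impI, elim conjE)
    fix Q Q1 Q2 Dh Gh D11 M11 M12 M22 Mh
    assume Q1: "Q1 \<in> carrier_mat n (n - k)" and Q2: "Q2 \<in> carrier_mat n k"
      and Q: "Q = block_row Q1 Q2" "unitary_mat n Q"
      and Dh: "Dh \<in> carrier_mat (n - k) n" and Gh: "Gh \<in> carrier_mat (n - k) r"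
      and QR: "mat_adjoint Q * block_row D G = four_block_mat Dh Gh (0\<^sub>m k n) (0\<^sub>m k r)"
      and rank_hat: "vec_space.rank (n - k) (block_row Dh Gh) = n - k"
      and D11: "D11 = mat_adjoint Q1 * D * Q1"
      and M11: "M11 \<in> carrier_mat (n - k) (n - k)" and M12: "M12 \<in> carrier_mat (n - k) k"
      and M22: "M22 \<in> carrier_mat k k"
      and M_blocks: "mat_adjoint Q * M * Q = four_block_mat M11 M12 (mat_adjoint M12) M22"
      and Mh: "Mh = schur_complement M11 M12 M22"
    have Qc: "Q \<in> carrier_mat n n" and QQ: "mat_adjoint Q * Q = 1\<^sub>m n" using Q(2) by (auto simp: unitary_mat_def)
    have "cnj (det Q) * det Q = 1"
      using det_mult[OF mat_adjoint_carrier[OF Qc] Qc] QQ det_mat_adjoint[OF Qc] by simp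
    hence det: "det (block_row Q1 Q2) \<noteq> 0" using Q(1) by auto
    have c: "mat_adjoint Q1 * D \<in> carrier_mat (n - k) n" "mat_adjoint Q1 * G \<in> carrier_mat (n - k) r"
      "mat_adjoint Q2 * D \<in> carrier_mat k n" "mat_adjoint Q2 * G \<in> carrier_mat k r"
      by (rule mult_carrier_mat mat_adjoint_carrier Q1 Q2 D(1) G(1))+
    have "four_block_mat (mat_adjoint Q1 * D) (mat_adjoint Q1 * G) (mat_adjoint Q2 * D) (mat_adjoint Q2 * G) =
      four_block_mat Dh Gh (0\<^sub>m k n) (0\<^sub>m k r)"
      using QR mat_adjoint_block_row_mult[OF Q1 Q2 D(1) G(1)] Q(1) by simp
    \<comment> \<open>Read blockwise, the QR equation identifies \<open>Dh\<close> and
      \<open>Gh\<close> as \<open>mat_adjoint Q1\<close> times \<open>D\<close> and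
      \<open>G\<close>, and says that \<open>mat_adjoint Q2\<close> annihilates both.\<close>
    note hat = four_block_mat_inj[OF this c(1) Dh c(2) Gh c(3) zero_carrier_mat c(4) zero_carrier_mat]
    interpret d: deflation n "n - k" k r M D G Q1 Q2
    proof
      have "mat_adjoint (mat_adjoint Q2 * D) = D * Q2" "mat_adjoint (mat_adjoint Q2 * G) = mat_adjoint G * Q2"
        using mat_adjoint_mult[of "mat_adjoint Q2" k n D n] mat_adjoint_mult[of "mat_adjoint Q2" k n G r]
          D_herm Q2 D(1) G(1) by simp_all
      thus "D * Q2 = 0\<^sub>m n k" "mat_adjoint G * Q2 = 0\<^sub>m r k" using hat by simp_all
      fix x assume x: "x \<in> carrier_vec (n - k)" "D *\<^sub>v (Q1 *\<^sub>v x) = 0\<^sub>v n" "mat_adjoint G *\<^sub>v (Q1 *\<^sub>v x) = 0\<^sub>v r"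
      have "mat_adjoint Dh = D * Q1" "mat_adjoint Gh = mat_adjoint G * Q1"
        using hat(1,2) mat_adjoint_mult[of "mat_adjoint Q1" "n - k" n D n]
          mat_adjoint_mult[of "mat_adjoint Q1" "n - k" n G r] D_herm Q1 D(1) G(1) by auto
      hence "mat_adjoint (block_row Dh Gh) *\<^sub>v x = 0\<^sub>v n @\<^sub>v 0\<^sub>v r"
        using mat_adjoint_block_row_mult_vec[OF Dh Gh x(1)] x assoc_mult_mat_vec[OF D(1) Q1 x(1)]
          assoc_mult_mat_vec[OF mat_adjoint_carrier[OF G(1)] Q1 x(1)] by simp
      also have "\<dots> = 0\<^sub>v (n + r)" by (intro eq_vecI) auto
      \<comment> \<open>Here the trivial kernel comes from the full row rank of
        \<open>[Dh Gh]\<close>, whose adjoint stacks \<open>D * Q1\<close> on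
        \<open>mat_adjoint G * Q1\<close>.\<close>
      finally show "x = 0\<^sub>v (n - k)"
        using full_row_rank_adjoint_inj[OF block_row_carrier[OF Dh Gh] rank_hat x(1)] by simp
    qed (use k M D G Q1 Q2 det G_inj in auto)
    have "mat_adjoint Q * M * Q = mat_adjoint (block_row Q1 Q2) * (M * block_row Q1 Q2)"
      using assoc_mult_mat[OF mat_adjoint_carrier[OF Qc] M(1) Qc] Q(1) by simp
    also have "\<dots> = four_block_mat d.M11 d.M12 (mat_adjoint Q2 * (M * Q1)) d.M22"
      unfolding d.M11_def d.M12_def d.M22_def mult_block_row[OF M(1) Q1 Q2]
      by (rule mat_adjoint_block_row_mult[OF Q1 Q2]) (use M(1) Q1 Q2 in auto)
    finally have "four_block_mat M11 M12 (mat_adjoint M12) M22 =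
      four_block_mat d.M11 d.M12 (mat_adjoint d.M12) d.M22" using M_blocks d.adjoint_M12 by simp
    \<comment> \<open>Both sides partition the same matrix with the same block sizes, so the given
      blocks are those of the locale and its results transfer.\<close>
    note M_eq = four_block_mat_inj[OF this M11 d.blocks_carrier(1) M12 d.blocks_carrier(2)
        mat_adjoint_carrier[OF M12] mat_adjoint_carrier[OF d.blocks_carrier(2)] M22 d.blocks_carrier(3)]
    have Mh_eq: "Mh = d.Mh" unfolding Mh d.Mh_def M_eq(1,2,4) ..
    have D11_eq: "D11 = d.D11" unfolding D11 d.D11_def
      using assoc_mult_mat[OF mat_adjoint_carrier[OF Q1] D(1) Q1] .
    have Gh_eq: "Gh = d.Gh" using hat(2) by (simp add: d.Gh_def)
    have sq: "square_mat (H_pencil d.Mh d.D11 d.Gh)" "square_mat (P_poly d.Mh d.D11 d.Gh)"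
      using d.Mh_carrier d.blocks_carrier by (auto simp: H_pencil_def Let_def P_poly_def)
    show "pos_def Mh \<and>
        (\<forall>z::complex. \<exists>X \<in> carrier_mat (n + r) (n + r). invertible_mat X \<and>
           mat_adjoint X * eval_matpoly (S_pencil M D G) z * X
             = diag_block_mat [eval_matpoly (H_pencil Mh D11 Gh) z, z \<cdot>\<^sub>m M22]) \<and>
        regular_matpoly (H_pencil Mh D11 Gh) \<and> regular_matpoly (P_poly Mh D11 Gh) \<and>
        eigvals (P_poly Mh D11 Gh) - {0} = eigvals (H_pencil Mh D11 Gh) \<and>
        eigvals (H_pencil Mh D11 Gh) = eigvals (S_pencil M D G) - {0} \<and>
        eigvals (S_pencil M D G) - {0} = eigvals (P_poly M D G) - {0} \<and>
        (n = k + r \<longrightarrow>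
           eigvals (P_poly Mh D11 Gh) = eigvals (H_pencil Mh D11 Gh) \<and>
           eigvals (H_pencil Mh D11 Gh) = eigvals (S_pencil M D G) - {0} \<and>
           eigvals (S_pencil M D G) - {0} = eigvals (P_poly M D G) - {0})"
      unfolding Mh_eq D11_eq Gh_eq M_eq(4)
      using d.pos_def_Mh d.invertible_congruence sq d.det_pencils_nonzero(1) d.P_hat_spectrum(1)
        d.eigvals_P_hat d.eigvals_H d.P_spectrum(4) d.eigvals_P_hat_square
      by (simp add: regular_matpoly_def)
  qed
qed

end
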